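(* Let $\theta\in[0,1]$ be irrational, let $X$ be the Sturmian subshift of slope $\theta$, let $\alpha>1$, let $t\in(1-1/\alpha,1)$ and set $\delta=(n^{-t})_{n\in\mathbb{N}}$. Let $\varrho_\alpha(t)=1-(\alpha-1)/(\alpha t)$. Then: (1) The metric $d_{s,\delta}$ is sequentially $\overline{\varrho_\alpha(t)}$-H\"older regular to the metric $d_\delta$ if and only if $\theta\in\overline{\Theta}_\alpha$. (2) The metric $d_{s,\delta}$ is sequentially $\underline{\varrho_\alpha(t)}$-H\"older regular to the metric $d_\delta$ if and only if $\theta\in\underline{\Theta}_\alpha$. Hence, $d_{s,\delta}$ is sequentially $\varrho_\alpha(t)$-H\"older regular to $d_\delta$ if and only if $\theta\in\Theta_\alpha$.
   Context: Continued fractions: for irrational $\theta\in[0,1]$ write $\theta=[0;a_1,a_2,\dots]$ with $a_n\in\mathbb{N}=\{1,2,\dots\}$, and set $q_0=1$, $q_1=a_1$, $q_n=a_nq_{n-1}+q_{n-2}$ for $n\ge2$. For $\alpha\ge1$ let $A_\alpha(\theta)=\limsup_{n\to\infty}a_nq_{n-1}^{1-\alpha}\in[0,\infty]$. Define (sets of irrational numbers) $\underline{\Theta}_\alpha=\{\theta\in[0,1]:A_\alpha(\theta)>0\}$, $\overline{\Theta}_\alpha=\{\theta\in[0,1]:A_\alpha(\theta)<\infty\}$, $\Theta_\alpha=\underline{\Theta}_\alpha\cap\overline{\Theta}_\alpha$. Sturmian subshift: $\{0,1\}^{\mathbb{N}}$ carries the product topology and $\sigma$ is the left shift. The Sturmian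 subshift of slope $\theta$ is the closure in $\{0,1\}^{\mathbb N}$ of $\{\sigma^k(x):k\ge0\}$, where $x=(x_n)_{n\in\mathbb{N}}$, $x_n=\lceil\theta(n+1)\rceil-\lceil\theta n\rceil$. The language $\mathcal{L}(X)$ is the set of all finite factors (including the empty word) of elements of $X$; a word $u\in\mathcal{L}(X)$ is right special if both $u0$ and $u1$ belong to $\mathcal{L}(X)$. Metrics: let $\delta=(\delta_n)_{n\in\mathbb{N}}$ be a strictly decreasing null sequence of positive reals. For $v\ne w$ in $X$, $|v\vee w|$ is the length of the longest common prefix of $v$ and $w$ (set equal to $1$ if there is no common prefix). The ultrametric is $d_\delta(v,w)=\delta_{|v\vee w|}$ for $v\neq w$, $d_\delta(v,v)=0$. The spectral metric (possibly taking the value $+\infty$) is, for $v\ne w$, $$d_{s,\delta}(v,w)=\delta_{|v\vee w|}+\sum_{n>|v\vee w|}\overline{b}_n(v)\,\delta_n+\sum_{n>|v\vee w|}\overline{b}_n(w)\,\delta_n,$$ and $d_{s,\delta}(v,v)=0$, where for $z=(z_1,z_2,\dots)\in X$, $\overline{b}_n(z)=1$ if $(z_1,\dots,z_n)$ is a right special word and $\overline{b}_n(z)=0$ otherwise. Sequential H\"older regularity: for $w\in X$ and $r>0$ let $\psi_w(r)=\limsup_{v\to w}d_{s,\delta}(w,v)/d_\delta(w,v)^r$, where $v\to w$ ($v\neq w$) with respect to $d_\delta$, and let $\psi(r)=\sup\{\psi_w(r):w\in X\}$. The metric $d_{s,\delta}$ is sequentially $\overline{r}$-H\"older regular to $d_\delta$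 if $\psi(r)<\infty$; sequentially $\underline{r}$-H\"older regular if $\psi(r)>0$; sequentially $r$-H\"older regular if $0<\psi(r)<\infty$. *)

theory Defs
  imports "HOL-Analysis.Analysis"
begin

section \<open>Continued fractions\<close>

text \<open>The expansion of an irrational number in \<open>[0,1]\<close> is generated by the Gauss map
  \<open>x \<mapsto> frac (1 / x)\<close>: with \<open>r\<^sub>0 = \<theta>\<close> and \<open>r\<^sub>n = frac (1 / r\<^sub>n\<^sub>-\<^sub>1)\<close>, the partial quotients are
  \<open>a\<^sub>n = \<lfloor>1 / r\<^sub>n\<^sub>-\<^sub>1\<rfloor>\<close> for \<open>n \<ge> 1\<close>.\<close>

fun cf_remainder :: "real \<Rightarrow> nat \<Rightarrow> real" where
  "cf_remainder \<theta> 0 = \<theta>"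
| "cf_remainder \<theta> (Suc n) = frac (1 / cf_remainder \<theta> n)"

fun cf_digit :: "real \<Rightarrow> nat \<Rightarrow> nat" where
  "cf_digit \<theta> 0 = 0"
| "cf_digit \<theta> (Suc n) = nat \<lfloor>1 / cf_remainder \<theta> n\<rfloor>"

fun cf_denom :: "real \<Rightarrow> nat \<Rightarrow> nat" where
  "cf_denom \<theta> 0 = 1"
| "cf_denom \<theta> (Suc 0) = cf_digit \<theta> 1"
| "cf_denom \<theta> (Suc (Suc n)) =
     cf_digit \<theta> (Suc (Suc n)) * cf_denom \<theta> (Suc n) + cf_denom \<theta> n"

definition cf_growth :: "real \<Rightarrow> real \<Rightarrow> ennreal" where
  "cf_growth \<alpha> \<theta> =
     limsup (\<lambda>n. ennreal (real (cf_digit \<theta> n) * real (cf_denom \<theta> (n - 1)) powr (1 - \<alpha>)))"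

definition Theta_lower :: "real \<Rightarrow> real set" where
  "Theta_lower \<alpha> = {\<theta> \<in> {0..1} - \<rat>. cf_growth \<alpha> \<theta> > 0}"

definition Theta_upper :: "real \<Rightarrow> real set" where
  "Theta_upper \<alpha> = {\<theta> \<in> {0..1} - \<rat>. cf_growth \<alpha> \<theta> < \<infinity>}"

definition Theta :: "real \<Rightarrow> real set" where
  "Theta \<alpha> = Theta_lower \<alpha> \<inter> Theta_upper \<alpha>"


section \<open>Sturmian subshifts\<close>

text \<open>Infinite words \<open>(z\<^sub>1, z\<^sub>2, \<dots>)\<close> are represented by functions
  on \<^typ>\<open>nat\<close> with \<open>z i\<close> being the letter \<open>z\<^sub>i\<^sub>+\<^sub>1\<close>. The letters are the integers 0 and 1.\<close>

definition shift :: "(nat \<Rightarrow> int) \<Rightarrow> nat \<Rightarrow> int" where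
  "shift z = (\<lambda>i. z (Suc i))"

definition sturmian_word :: "real \<Rightarrow> nat \<Rightarrow> int" where
  "sturmian_word \<theta> = (\<lambda>i. let n = Suc i in \<lceil>\<theta> * real (n + 1)\<rceil> - \<lceil>\<theta> * real n\<rceil>)"

definition sturmian_subshift :: "real \<Rightarrow> (nat \<Rightarrow> int) set" where
  "sturmian_subshift \<theta> =
     product_topology (\<lambda>_. discrete_topology {0, 1}) UNIV
       closure_of {(shift ^^ k) (sturmian_word \<theta>) | k. True}"

definition word_prefix :: "(nat \<Rightarrow> int) \<Rightarrow> nat \<Rightarrow> int list" where
  "word_prefix z n = map z [0..<n]"

definition language :: "(nat \<Rightarrow> int) set \<Rightarrow> int list set" where
  "language X = {map z [k..<k + n] | z k n. z \<in> X}"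

definition right_special :: "(nat \<Rightarrow> int) set \<Rightarrow> int list \<Rightarrow> bool" where
  "right_special X u \<longleftrightarrow>
     u \<in> language X \<and> u @ [0] \<in> language X \<and> u @ [1] \<in> language X"


section \<open>The ultrametric and the spectral metric\<close>

text \<open>Only used for distinct words; words without a common nonempty prefix get the value 1.\<close>

definition common_prefix_length :: "(nat \<Rightarrow> int) \<Rightarrow> (nat \<Rightarrow> int) \<Rightarrow> nat" where
  "common_prefix_length v w =
     (let m = (GREATEST n. word_prefix v n = word_prefix w n) in if m = 0 then 1 else m)"

definition ultrametric :: "(nat \<Rightarrow> real) \<Rightarrow> (nat \<Rightarrow> int) \<Rightarrow> (nat \<Rightarrow> int) \<Rightarrow> real" where
  "ultrametric \<delta> v w = (if v = w then 0 else \<delta> (common_prefix_length v w))"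

definition special_indicator :: "(nat \<Rightarrow> int) set \<Rightarrow> nat \<Rightarrow> (nat \<Rightarrow> int) \<Rightarrow> real" where
  "special_indicator X n z = (if right_special X (word_prefix z n) then 1 else 0)"

definition spectral_metric ::
    "(nat \<Rightarrow> int) set \<Rightarrow> (nat \<Rightarrow> real) \<Rightarrow> (nat \<Rightarrow> int) \<Rightarrow> (nat \<Rightarrow> int) \<Rightarrow> ennreal" where
  "spectral_metric X \<delta> v w =
     (if v = w then 0
      else ennreal (\<delta> (common_prefix_length v w))
         + (\<Sum>\<^sub>\<infinity>n\<in>{common_prefix_length v w<..}. ennreal (special_indicator X n v * \<delta> n))
         + (\<Sum>\<^sub>\<infinity>n\<in>{common_prefix_length v w<..}. ennreal (special_indicator X n w * \<delta> n)))"


section \<open>Sequential Hoelder regularity\<close>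

definition punctured_nhds :: "'a set \<Rightarrow> ('a \<Rightarrow> 'a \<Rightarrow> real) \<Rightarrow> 'a \<Rightarrow> 'a filter" where
  "punctured_nhds X d w = (INF \<epsilon>\<in>{0<..}. principal {v \<in> X. v \<noteq> w \<and> d w v < \<epsilon>})"

definition holder_psi_at ::
    "'a set \<Rightarrow> ('a \<Rightarrow> 'a \<Rightarrow> ennreal) \<Rightarrow> ('a \<Rightarrow> 'a \<Rightarrow> real) \<Rightarrow> real \<Rightarrow> 'a \<Rightarrow> ennreal" where
  "holder_psi_at X ds d r w =
     Limsup (punctured_nhds X d w) (\<lambda>v. ds w v / ennreal (d w v powr r))"

definition holder_psi ::
    "'a set \<Rightarrow> ('a \<Rightarrow> 'a \<Rightarrow> ennreal) \<Rightarrow> ('a \<Rightarrow> 'a \<Rightarrow> real) \<Rightarrow> real \<Rightarrow> ennreal" where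
  "holder_psi X ds d r = (SUP w\<in>X. holder_psi_at X ds d r w)"

definition seq_upper_holder_regular ::
    "'a set \<Rightarrow> ('a \<Rightarrow> 'a \<Rightarrow> ennreal) \<Rightarrow> ('a \<Rightarrow> 'a \<Rightarrow> real) \<Rightarrow> real \<Rightarrow> bool" where
  "seq_upper_holder_regular X ds d r \<longleftrightarrow> holder_psi X ds d r < \<infinity>"

definition seq_lower_holder_regular ::
    "'a set \<Rightarrow> ('a \<Rightarrow> 'a \<Rightarrow> ennreal) \<Rightarrow> ('a \<Rightarrow> 'a \<Rightarrow> real) \<Rightarrow> real \<Rightarrow> bool" where
  "seq_lower_holder_regular X ds d r \<longleftrightarrow> holder_psi X ds d r > 0"

definition seq_holder_regular ::
    "'a set \<Rightarrow> ('a \<Rightarrow> 'a \<Rightarrow> ennreal) \<Rightarrow> ('a \<Rightarrow> 'a \<Rightarrow> real) \<Rightarrow> real \<Rightarrow> bool" where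
  "seq_holder_regular X ds d r \<longleftrightarrow> 0 < holder_psi X ds d r \<and> holder_psi X ds d r < \<infinity>"

definition critical_exponent :: "real \<Rightarrow> real \<Rightarrow> real" where
  "critical_exponent \<alpha> t = 1 - (\<alpha> - 1) / (\<alpha> * t)"

end

theory Submission
  imports Defs
begin

text \<open>Let \<open>s = t - 1 + 1 / \<alpha>\<close>, so that the denominator of the Hoelder quotient of two words with
  longest common prefix of length \<open>N\<close> is \<open>N powr (- s)\<close>, while the numerator consists of \<open>N powr (- t)\<close>
  and the tails \<open>\<Sum>k>N. k powr (- t)\<close> over the lengths \<open>k\<close> of right special prefixes. Two such lengths
  \<open>k < k'\<close> with \<open>k + 1 \<ge> q\<^sub>l\<close> differ by at least \<open>q\<^sub>l\<close>, because the points \<open>- (k + 1) \<theta>\<close> and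
  \<open>- (k' + 1) \<theta>\<close> are closer to each other than \<open>\<parallel>q\<^sub>l\<^sub>-\<^sub>1 \<theta>\<parallel>\<close>. The lengths in \<open>[q\<^sub>l, q\<^sub>l\<^sub>+\<^sub>1)\<close> therefore
  contribute at most a multiple of \<open>q\<^sub>l\<^sub>+\<^sub>1 powr (1 - t) / q\<^sub>l\<close>, which by \<open>q\<^sub>l\<^sub>+\<^sub>1 \<le> 2 a\<^sub>l\<^sub>+\<^sub>1 q\<^sub>l\<close> is at most a
  multiple of \<open>(a\<^sub>l\<^sub>+\<^sub>1 q\<^sub>l powr (1 - \<alpha>)) powr (1 / \<alpha>) * q\<^sub>l\<^sub>+\<^sub>1 powr (- s)\<close>; summing over \<open>l\<close> is a geometric
  series. Conversely, the word \<open>sturmian_word \<theta>\<close> agrees with its shift by \<open>(i + 1) q\<^sub>l\<close> exactly up to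
  length \<open>q\<^sub>l\<^sub>+\<^sub>1 - i q\<^sub>l - 2\<close>, so these are lengths of right special prefixes, and those with
  \<open>i < a\<^sub>l\<^sub>+\<^sub>1 / 2\<close> already give a matching lower bound at \<open>N \<approx> q\<^sub>l\<^sub>+\<^sub>1 / 2\<close>.\<close>

section \<open>Continued fractions and best approximation\<close>

fun cf_numer :: "real \<Rightarrow> nat \<Rightarrow> nat" where
  "cf_numer \<theta> 0 = 0"
| "cf_numer \<theta> (Suc 0) = 1"
| "cf_numer \<theta> (Suc (Suc n)) =
     cf_digit \<theta> (Suc (Suc n)) * cf_numer \<theta> (Suc n) + cf_numer \<theta> n"

text \<open>Kept signed rather than as a distance: the sign alternates with \<open>n\<close>, and
  the later floor arguments depend on which side of an integer a point lies.\<close>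

definition cf_error :: "real \<Rightarrow> nat \<Rightarrow> real" where
  "cf_error \<theta> n = real (cf_denom \<theta> n) * \<theta> - real (cf_numer \<theta> n)"

declare cf_remainder.simps(2) [simp del] cf_digit.simps(2) [simp del]

lemma abs_add_same_sign:
  fixes x y :: "'a::linordered_idom"
  assumes "0 \<le> x * y"
  shows "\<bar>x + y\<bar> = \<bar>x\<bar> + \<bar>y\<bar>"
  using assms by (auto simp: abs_if zero_le_mult_iff)

lemma Rats_frac_iff: "frac x \<in> \<rat> \<longleftrightarrow> x \<in> \<rat>" for x :: real
  unfolding frac_def by (metis Rats_add Rats_diff Rats_of_int diff_add_cancel)

locale unit_irrational =
  fixes \<theta> :: real
  assumes theta_unit: "\<theta> \<in> {0..1}" and theta_irrational: "\<theta> \<notin> \<rat>"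
begin

section \<open>The Gauss map orbit and the partial quotients\<close>

lemma cf_remainder_irrational: "cf_remainder \<theta> n \<notin> \<rat>"
  by (induction n) (simp_all add: theta_irrational cf_remainder.simps(2) Rats_frac_iff divide_inverse)

lemma cf_remainder_gt_0: "0 < cf_remainder \<theta> n"
  and cf_remainder_lt_1: "cf_remainder \<theta> n < 1"
proof -
  have "cf_remainder \<theta> n \<noteq> 0" "cf_remainder \<theta> n \<noteq> 1"
    using cf_remainder_irrational[of n] by (metis Rats_0, metis Rats_1)
  moreover have "0 \<le> cf_remainder \<theta> n \<and> cf_remainder \<theta> n \<le> 1"
    by (cases n) (use theta_unit in \<open>auto simp: cf_remainder.simps(2) less_imp_le[OF frac_lt_1]\<close>)
  ultimately show "0 < cf_remainder \<theta> n" "cf_remainder \<theta> n < 1" by auto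
qed

lemma inverse_cf_remainder:
  "1 / cf_remainder \<theta> n = real (cf_digit \<theta> (Suc n)) + cf_remainder \<theta> (Suc n)"
  using cf_remainder_gt_0[of n] by (simp add: frac_def cf_digit.simps(2) cf_remainder.simps(2))

lemma cf_digit_pos: "0 < cf_digit \<theta> (Suc n)"
proof -
  have "1 < 1 / cf_remainder \<theta> n"
    using cf_remainder_gt_0[of n] cf_remainder_lt_1[of n] by simp
  then show ?thesis
    by (simp add: cf_digit.simps(2))
qed

section \<open>Growth of the denominators\<close>

lemma cf_denom_pos: "0 < cf_denom \<theta> n"
  by (induction n rule: induct_nat_012) (use cf_digit_pos in \<open>auto\<close>)

lemma cf_denom_le_Suc: "cf_denom \<theta> n \<le> cf_denom \<theta> (Suc n)"
proof (cases n)
  case 0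
  then show ?thesis using cf_digit_pos[of 0] by (simp)
next
  case (Suc m)
  then show ?thesis using cf_digit_pos[of n]
    by (simp add: trans_le_add1)
qed

lemma cf_denom_mono: "m \<le> n \<Longrightarrow> cf_denom \<theta> m \<le> cf_denom \<theta> n"
  using lift_Suc_mono_le[of "cf_denom \<theta>"] cf_denom_le_Suc by blast

text \<open>A partial quotient may be 1, so one step need not double the denominator. Two steps do,
  by \<open>q\<^sub>n\<^sub>+\<^sub>2 \<ge> q\<^sub>n\<^sub>+\<^sub>1 + q\<^sub>n\<close>; this is
  the source of the rate \<open>sqrt 2\<close> below.\<close>

lemma cf_denom_double: "2 * cf_denom \<theta> n \<le> cf_denom \<theta> (Suc (Suc n))"
proof -
  have "cf_denom \<theta> (Suc n) \<le> cf_digit \<theta> (Suc (Suc n)) * cf_denom \<theta> (Suc n)"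
    using cf_digit_pos[of "Suc n"] by simp
  then have "cf_denom \<theta> n \<le> cf_digit \<theta> (Suc (Suc n)) * cf_denom \<theta> (Suc n)"
    using cf_denom_le_Suc[of n] by (rule order_trans[rotated])
  then show ?thesis by simp
qed

text \<open>The summand from two steps back is at most \<open>cf_denom \<theta> n\<close> and is
  absorbed by a second copy of the leading product.\<close>

lemma cf_denom_Suc_le: "cf_denom \<theta> (Suc n) \<le> 2 * cf_digit \<theta> (Suc n) * cf_denom \<theta> n"
proof (cases n)
  case (Suc m)
  have "cf_denom \<theta> m \<le> cf_denom \<theta> n"
    using Suc cf_denom_le_Suc by simp
  also have "\<dots> \<le> cf_digit \<theta> (Suc n) * cf_denom \<theta> n"
    using cf_digit_pos[of n] by simp
  finally show ?thesis using Suc by (simp add: algebra_simps)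
qed simp

lemma cf_denom_at_top: "filterlim (cf_denom \<theta>) at_top sequentially"
proof -
  have *: "n \<le> cf_denom \<theta> (2 * n)" for n
  proof (induction n)
    case (Suc n)
    show ?case using cf_denom_double[of "2 * n"] cf_denom_pos[of "2 * n"] Suc by simp
  qed simp
  show ?thesis
    unfolding filterlim_at_top eventually_sequentially
  proof (intro allI exI impI)
    fix m n :: nat assume "2 * m \<le> n"
    then show "m \<le> cf_denom \<theta> n" using *[of m] cf_denom_mono[of "2 * m" n] by linarith
  qed
qed

section \<open>Errors of the convergents and best approximation\<close>

text \<open>The errors satisfy the same recursion as the denominators, and
  \<open>inverse_cf_remainder\<close> turns \<open>1 - a * r\<close> into the product of two
  consecutive remainders. Alternation and strict decrease of the errors both follow from this
  product.\<close>

lemma cf_error_eq: "cf_error \<theta> n = (- 1) ^ n * (\<Prod>i\<le>n. cf_remainder \<theta> i)"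
proof (induction n rule: induct_nat_012)
  case 0
  then show ?case by (simp add: cf_error_def)
next
  case 1
  have "real (cf_digit \<theta> (Suc 0)) = 1 / \<theta> - cf_remainder \<theta> (Suc 0)"
    using inverse_cf_remainder[of 0] by simp
  then show ?case using cf_remainder_gt_0[of 0]
    by (simp add: cf_error_def field_simps)
next
  case (ge2 n)
  let ?P = "\<Prod>i\<le>n. cf_remainder \<theta> i" and ?r = "cf_remainder \<theta> (Suc n)"
  have "cf_error \<theta> (Suc (Suc n)) =
      real (cf_digit \<theta> (Suc (Suc n))) * cf_error \<theta> (Suc n) + cf_error \<theta> n"
    by (simp add: cf_error_def algebra_simps)
  also have "\<dots> = (- 1) ^ n * ?P * (1 - real (cf_digit \<theta> (Suc (Suc n))) * ?r)"
    by (simp add: ge2 algebra_simps)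
  also have "1 - real (cf_digit \<theta> (Suc (Suc n))) * ?r = ?r * cf_remainder \<theta> (Suc (Suc n))"
    using inverse_cf_remainder[of "Suc n"] cf_remainder_gt_0[of "Suc n"]
    by (simp add: field_simps)
  finally show ?case
    by (simp add: mult.assoc)
qed

lemma cf_error_Suc: "cf_error \<theta> (Suc n) = - cf_remainder \<theta> (Suc n) * cf_error \<theta> n"
  by (simp add: cf_error_eq)

lemma cf_error_nonzero: "cf_error \<theta> n \<noteq> 0"
  using cf_remainder_gt_0 by (simp add: cf_error_eq less_imp_neq[symmetric])

lemma cf_error_alternating: "cf_error \<theta> n * cf_error \<theta> (Suc n) < 0"
proof -
  have "0 < cf_error \<theta> n * cf_error \<theta> n"
    using cf_error_nonzero not_real_square_gt_zero by blast
  with cf_remainder_gt_0 have "0 < cf_remainder \<theta> (Suc n) * (cf_error \<theta> n * cf_error \<theta> n)"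
    by (rule mult_pos_pos)
  then show ?thesis by (simp add: cf_error_Suc algebra_simps)
qed

lemma abs_cf_error_Suc_less: "\<bar>cf_error \<theta> (Suc n)\<bar> < \<bar>cf_error \<theta> n\<bar>"
  using cf_remainder_gt_0[of "Suc n"] cf_remainder_lt_1[of "Suc n"] cf_error_nonzero[of n]
  by (simp add: cf_error_Suc abs_mult)

text \<open>Each step of the recursion reverses the sign of the determinant. Consecutive pairs of
  denominator and numerator therefore form a basis of the integer lattice, which provides the
  coordinates in \<open>best_approximation\<close>.\<close>

lemma cf_determinant:
  "int (cf_numer \<theta> (Suc n)) * int (cf_denom \<theta> n)
     - int (cf_numer \<theta> n) * int (cf_denom \<theta> (Suc n)) = (- 1) ^ n"
proof (induction n)
  case (Suc n)
  then show ?case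
    by (simp add: algebra_simps)
qed simp

text \<open>Lagrange's argument: in the lattice basis given by the convergents \<open>n\<close> and
  \<open>n + 1\<close>, the pair of \<open>d\<close> and \<open>m\<close> has coordinates
  \<open>x \<noteq> 0\<close> and \<open>y\<close> of weakly opposite signs. Since the errors
  alternate, their contributions add up instead of cancelling.\<close>

lemma best_approximation:
  fixes d :: nat and m :: int
  assumes "0 < d" "d < cf_denom \<theta> (Suc n)"
  shows "\<bar>cf_error \<theta> n\<bar> \<le> \<bar>real d * \<theta> - of_int m\<bar>"
proof -
  define p p' q q' where
    "p = int (cf_numer \<theta> n)" and "p' = int (cf_numer \<theta> (Suc n))" and
    "q = int (cf_denom \<theta> n)" and "q' = int (cf_denom \<theta> (Suc n))"
  define s :: int where "s = (- 1) ^ n"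
  have det: "p' * q - p * q' = s" and s: "s * s = 1"
    unfolding p_def p'_def q_def q'_def s_def by (rule cf_determinant) (simp flip: power_add)
  \<comment> \<open>Cramer's rule; the determinant \<open>s\<close> is its own inverse.\<close>
  define x y where "x = s * (p' * int d - q' * m)" and "y = s * (q * m - p * int d)"
  have d_eq: "int d = x * q + y * q'"
  proof -
    have "x * q + y * q' = s * ((p' * q - p * q') * int d)"
      by (simp add: x_def y_def algebra_simps)
    then show ?thesis by (simp add: det s flip: mult.assoc)
  qed
  have m_eq: "m = x * p + y * p'"
  proof -
    have "x * p + y * p' = s * ((p' * q - p * q') * m)"
      by (simp add: x_def y_def algebra_simps)
    then show ?thesis by (simp add: det s flip: mult.assoc)
  qed
  have q_pos: "0 < q" "0 < q'" and d: "0 < int d" "int d < q'"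
    using cf_denom_pos assms by (simp_all add: q_def q'_def)
  \<comment> \<open>Otherwise \<open>d\<close> would be a multiple of \<open>q'\<close> strictly
    between 0 and \<open>q'\<close>.\<close>
  have x_nz: "x \<noteq> 0"
  proof
    assume "x = 0"
    then have "int d = y * q'" using d_eq by simp
    then show False using d q_pos zdvd_not_zless[OF d] by simp
  qed
  \<comment> \<open>Coordinates of equal strict sign would give \<open>int d > q'\<close> or
    \<open>int d < 0\<close>.\<close>
  have xy: "x * y \<le> 0"
  proof (rule ccontr)
    assume "\<not> x * y \<le> 0"
    then have "0 < x \<and> 0 < y \<or> x < 0 \<and> y < 0" by (auto simp: not_le zero_less_mult_iff)
    then show False
    proof
      assume "0 < x \<and> 0 < y"
      then have "1 * q' \<le> y * q'" "0 < x * q" using q_pos by (auto intro: mult_right_mono)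
      then show False using d_eq d by linarith
    next
      assume "x < 0 \<and> y < 0"
      then have "y * q' < 0" "x * q < 0" using q_pos by (simp_all add: mult_neg_pos)
      then show False using d_eq d by linarith
    qed
  qed
  have real_eq: "real d * \<theta> - of_int m = of_int x * cf_error \<theta> n + of_int y * cf_error \<theta> (Suc n)"
  proof -
    have "real d = of_int x * of_int q + of_int y * of_int q'"
      by (metis d_eq of_int_add of_int_mult of_int_of_nat_eq)
    moreover have "real_of_int m = of_int x * of_int p + of_int y * of_int p'"
      by (simp add: m_eq)
    ultimately show ?thesis
      by (simp add: cf_error_def p_def p'_def q_def q'_def algebra_simps)
  qed
  have "0 \<le> (real_of_int x * of_int y) * (cf_error \<theta> n * cf_error \<theta> (Suc n))"
    using xy cf_error_alternating[of n] by (intro mult_nonpos_nonpos) (simp_all flip: of_int_mult)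
  then have "\<bar>real d * \<theta> - of_int m\<bar> = \<bar>of_int x * cf_error \<theta> n\<bar> + \<bar>of_int y * cf_error \<theta> (Suc n)\<bar>"
    unfolding real_eq by (intro abs_add_same_sign) (simp add: mult_ac)
  also have "\<dots> \<ge> \<bar>of_int x * cf_error \<theta> n\<bar>" by simp
  also have "\<bar>of_int x * cf_error \<theta> n\<bar> \<ge> 1 * \<bar>cf_error \<theta> n\<bar>"
    unfolding abs_mult using x_nz by (intro mult_right_mono) (auto simp: Ints_nonzero_abs_ge1)
  finally show ?thesis by simp
qed

lemma no_integer_multiple: "0 < d \<Longrightarrow> real d * \<theta> \<noteq> of_int m"
proof
  assume "0 < d" "real d * \<theta> = of_int m"
  then have "\<theta> = of_int m / real d" by (simp add: field_simps)
  then show False using theta_irrational by simp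
qed

end

section \<open>Right special prefixes and their gaps\<close>

lemma funpow_shift: "(shift ^^ m) z i = z (m + i)"
  by (induction m arbitrary: i) (simp_all add: shift_def)

text \<open>The cylinder that fixes the first \<open>n\<close> letters of \<open>z\<close> is open,
  because it restricts finitely many coordinates only. As a neighbourhood of a point of the closure
  it meets the orbit.\<close>

lemma sturmian_subshift_prefix:
  assumes "z \<in> sturmian_subshift \<theta>"
  obtains m where "\<And>i. i < n \<Longrightarrow> z i = sturmian_word \<theta> (m + i)"
proof -
  let ?T = "product_topology (\<lambda>_. discrete_topology {0, 1::int}) (UNIV :: nat set)"
  let ?U = "\<Pi>\<^sub>E i\<in>UNIV. if i < n then {z i} else {0, 1}"
  have z: "z i \<in> {0, 1}" for i
    using assms unfolding sturmian_subshift_def in_closure_of by auto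
  have "{i. (if i < n then {z i} else {0, 1}) \<noteq> {0, 1}} \<subseteq> {..<n}"
    by auto
  then have "openin ?T ?U"
    using z by (intro product_topology_basis) (auto intro: finite_subset)
  moreover have "z \<in> ?U" using z by auto
  ultimately obtain y where y: "y \<in> {(shift ^^ k) (sturmian_word \<theta>) | k. True}" "y \<in> ?U"
    using assms unfolding sturmian_subshift_def in_closure_of by blast
  then obtain m where m: "y = (shift ^^ m) (sturmian_word \<theta>)" by blast
  have "z i = y i" if "i < n" for i
    using y(2) that by (auto simp: PiE_iff dest: spec[of _ i])
  then show thesis
    using that[of m] by (simp add: m funpow_shift)
qed

context unit_irrational
begin

text \<open>No positive multiple of \<theta> is an integer, so each ceiling is a floor plus 1 and
  the two extra units cancel. Letter \<open>i\<close> involves the multiples \<open>i + 1\<close>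
  and \<open>i + 2\<close>, whence the \<open>+ 2\<close> in later conditions on lengths.\<close>

lemma sturmian_word_eq_floor:
  "sturmian_word \<theta> i = \<lfloor>real (i + 2) * \<theta>\<rfloor> - \<lfloor>real (i + 1) * \<theta>\<rfloor>"
proof -
  have ceiling: "\<lceil>\<theta> * real d\<rceil> = \<lfloor>real d * \<theta>\<rfloor> + 1" if "0 < d" for d
    using no_integer_multiple[OF that] unfolding ceiling_altdef
    by (metis mult.commute)
  show ?thesis
    using ceiling[of "i + 2"] ceiling[of "i + 1"] by (simp add: sturmian_word_def Let_def)
qed

lemma sturmian_word_sum:
  "(\<Sum>j<n. sturmian_word \<theta> (m + j)) = \<lfloor>real (m + n + 1) * \<theta>\<rfloor> - \<lfloor>real (m + 1) * \<theta>\<rfloor>"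
  by (induction n) (simp_all add: sturmian_word_eq_floor add_ac)

lemma sturmian_word_letters: "sturmian_word \<theta> i \<in> {0, 1}"
proof -
  let ?x = "real (i + 1) * \<theta>"
  have "\<theta> < 1" using theta_unit theta_irrational by (metis Rats_1 atLeastAtMost_iff less_eq_real_def)
  then have "\<lfloor>?x\<rfloor> \<le> \<lfloor>?x + \<theta>\<rfloor>" "\<lfloor>?x + \<theta>\<rfloor> \<le> \<lfloor>?x\<rfloor> + 1"
    using theta_unit by (auto intro!: floor_mono) linarith
  moreover have "real (i + 2) * \<theta> = ?x + \<theta>" by (simp add: algebra_simps)
  ultimately show ?thesis by (auto simp: sturmian_word_eq_floor simp del: of_nat_add)
qed

lemma shift_sturmian_word_in_subshift: "(shift ^^ m) (sturmian_word \<theta>) \<in> sturmian_subshift \<theta>"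
proof -
  have "(shift ^^ k) (sturmian_word \<theta>) \<in> UNIV \<rightarrow>\<^sub>E {0, 1}" for k
    using sturmian_word_letters by (simp add: PiE_UNIV_domain funpow_shift Pi_iff del: insert_iff)
  then show ?thesis
    unfolding sturmian_subshift_def by (intro subsetD[OF closure_of_subset]) auto
qed

lemma sturmian_word_in_subshift: "sturmian_word \<theta> \<in> sturmian_subshift \<theta>"
  using shift_sturmian_word_in_subshift[of 0] by simp

text \<open>Taking the closure of the orbit adds no finite factors, since every finite window of a
  limit word already occurs in the orbit.\<close>

lemma language_sturmian_subshift:
  "u \<in> language (sturmian_subshift \<theta>) \<longleftrightarrow>
     (\<exists>m. \<forall>i<length u. u ! i = sturmian_word \<theta> (m + i))"
proof
  assume "u \<in> language (sturmian_subshift \<theta>)"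
  then obtain z k n where z: "z \<in> sturmian_subshift \<theta>" and u: "u = map z [k..<k + n]"
    unfolding language_def by blast
  obtain m where m: "\<And>i. i < k + n \<Longrightarrow> z i = sturmian_word \<theta> (m + i)"
    using sturmian_subshift_prefix[OF z] by metis
  show "\<exists>m. \<forall>i<length u. u ! i = sturmian_word \<theta> (m + i)"
    using m by (intro exI[of _ "m + k"]) (simp add: u add_ac)
next
  assume "\<exists>m. \<forall>i<length u. u ! i = sturmian_word \<theta> (m + i)"
  then obtain m where "\<forall>i<length u. u ! i = sturmian_word \<theta> (m + i)" by blast
  then have "u = map (sturmian_word \<theta>) [m..<m + length u]"
    by (intro nth_equalityI) simp_all
  then show "u \<in> language (sturmian_subshift \<theta>)"
    unfolding language_def using sturmian_word_in_subshift by blast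
qed

lemma extension_in_language_iff:
  "word_prefix z k @ [b] \<in> language (sturmian_subshift \<theta>) \<longleftrightarrow>
     (\<exists>m. (\<forall>i<k. z i = sturmian_word \<theta> (m + i)) \<and> b = sturmian_word \<theta> (m + k))"
  by (auto simp: language_sturmian_subshift word_prefix_def nth_append less_Suc_eq)

text \<open>The words in the subshift with the same prefix of length \<open>k\<close> as \<open>z\<close> correspond to an
  interval of the circle. If the prefix is right special, then this interval is split by the next
  point \<open>u = - (k + 1) \<theta>\<close> (mod 1) of the backward orbit of \<open>0\<close>.\<close>

lemma right_special_prefix_splitting_point:
  assumes "right_special (sturmian_subshift \<theta>) (word_prefix z k)"
  obtains u and p :: int where "u + real (k + 1) * \<theta> = of_int p"
    and "\<And>i. i \<le> k \<Longrightarrow> \<lfloor>u + real i * \<theta>\<rfloor> = (\<Sum>j<i. z j)"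
proof -
  \<comment> \<open>Two occurrences of the prefix in the generating word, one followed by 0 and one
    by 1.\<close>
  obtain m0 m1 where m0: "\<And>i. i < k \<Longrightarrow> z i = sturmian_word \<theta> (m0 + i)" "sturmian_word \<theta> (m0 + k) = 0"
    and m1: "\<And>i. i < k \<Longrightarrow> z i = sturmian_word \<theta> (m1 + i)" "sturmian_word \<theta> (m1 + k) = 1"
    using assms unfolding right_special_def extension_in_language_iff by metis
  define x where "x m = frac (real (m + 1) * \<theta>)" for m :: nat
  have floor_x: "\<lfloor>x m + real i * \<theta>\<rfloor> = (\<Sum>j<i. sturmian_word \<theta> (m + j))" for m i
  proof -
    have "x m + real i * \<theta> = real (m + i + 1) * \<theta> - of_int \<lfloor>real (m + 1) * \<theta>\<rfloor>"
      by (simp add: x_def frac_def algebra_simps)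
    then show ?thesis by (simp only: floor_diff_of_int sturmian_word_sum)
  qed
  have floor0: "\<lfloor>x m0 + real i * \<theta>\<rfloor> = (\<Sum>j<i. z j)" if "i \<le> k" for i
    unfolding floor_x using that by (intro sum.cong) (simp_all add: m0)
  have floor1: "\<lfloor>x m1 + real i * \<theta>\<rfloor> = (\<Sum>j<i. z j)" if "i \<le> k" for i
    unfolding floor_x using that by (intro sum.cong) (simp_all add: m1)
  \<comment> \<open>After \<open>k + 1\<close> rotations the point \<open>x m1\<close> has reached
    the integer \<open>p\<close> and \<open>x m0\<close> has not. Hence the point \<open>u\<close>
    that lands exactly on \<open>p\<close> lies between them.\<close>
  define p where "p = (\<Sum>j<k. z j) + 1"
  define u where "u = of_int p - real (k + 1) * \<theta>"
  have "\<lfloor>x m0 + real (k + 1) * \<theta>\<rfloor> = p - 1"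
    unfolding floor_x using floor0[of k] m0(2) by (simp add: floor_x p_def)
  then have "x m0 \<le> u" unfolding u_def by linarith
  have "\<lfloor>x m1 + real (k + 1) * \<theta>\<rfloor> = p"
    unfolding floor_x using floor1[of k] m1(2) by (simp add: floor_x p_def)
  then have "u \<le> x m1" unfolding u_def by linarith
  \<comment> \<open>Floors are monotone, and those at \<open>x m0\<close> and \<open>x m1\<close>
    agree up to \<open>k\<close>, so the point \<open>u\<close> in between has the same
    coding.\<close>
  have "\<lfloor>u + real i * \<theta>\<rfloor> = (\<Sum>j<i. z j)" if "i \<le> k" for i
  proof (rule antisym)
    show "\<lfloor>u + real i * \<theta>\<rfloor> \<le> (\<Sum>j<i. z j)"
      using \<open>u \<le> x m1\<close> by (simp flip: floor1[OF that] add: floor_mono)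
    show "(\<Sum>j<i. z j) \<le> \<lfloor>u + real i * \<theta>\<rfloor>"
      using \<open>x m0 \<le> u\<close> by (simp flip: floor0[OF that] add: floor_mono)
  qed
  moreover have "u + real (k + 1) * \<theta> = of_int p" by (simp add: u_def)
  ultimately show thesis using that by blast
qed

text \<open>The splitting points of both prefixes have the same coding up to \<open>k\<close>. This
  puts them closer together than \<open>\<bar>cf_error \<theta> n\<bar>\<close> with
  \<open>l = Suc n\<close>, while they differ by \<open>k' - k\<close> rotations;
  \<open>best_approximation\<close> then excludes a difference below
  \<open>cf_denom \<theta> l\<close>.\<close>

lemma right_special_gap:
  assumes k: "right_special (sturmian_subshift \<theta>) (word_prefix z k)"
    and k': "right_special (sturmian_subshift \<theta>) (word_prefix z k')"
    and less: "k < k'" and q: "cf_denom \<theta> l \<le> k + 1"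
  shows "k + cf_denom \<theta> l \<le> k'"
proof (cases l)
  case 0
  then show ?thesis using less by simp
next
  case (Suc n)
  obtain u and p :: int where up: "u + real (k + 1) * \<theta> = of_int p"
    and u: "\<And>i. i \<le> k \<Longrightarrow> \<lfloor>u + real i * \<theta>\<rfloor> = (\<Sum>j<i. z j)"
    using right_special_prefix_splitting_point[OF k] by metis
  obtain u' and p' :: int where up': "u' + real (k' + 1) * \<theta> = of_int p'"
    and u': "\<And>i. i \<le> k' \<Longrightarrow> \<lfloor>u' + real i * \<theta>\<rfloor> = (\<Sum>j<i. z j)"
    using right_special_prefix_splitting_point[OF k'] by metis
  define d where "d = k' - k"
  have d: "0 < d" "k' = k + d" using less by (simp_all add: d_def)
  have diff: "u' - u = of_int (p' - p) - real d * \<theta>"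
    using up up' by (simp add: d algebra_simps)
  \<comment> \<open>Equality would make a positive multiple of \<theta> an integer; this makes the
    barriers strict.\<close>
  have neq: "u' - u \<noteq> cf_error \<theta> j" for j
  proof
    assume "u' - u = cf_error \<theta> j"
    then have "real (d + cf_denom \<theta> j) * \<theta> = of_int (p' - p + int (cf_numer \<theta> j))"
      unfolding diff cf_error_def by (simp add: algebra_simps)
    then show False using no_integer_multiple d by (metis add_gr_0)
  qed
  text \<open>The points \<open>u + cf_error \<theta> j\<close> belong to the orbit segment that bounds the interval of the
    prefix of length \<open>k\<close>, so that \<open>u'\<close> cannot be beyond them.\<close>
  have barrier: "(cf_error \<theta> j < 0 \<longrightarrow> cf_error \<theta> j < u' - u) \<and>
      (0 < cf_error \<theta> j \<longrightarrow> u' - u < cf_error \<theta> j)"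
    if j: "cf_denom \<theta> j \<le> k + 1" for j
  proof -
    \<comment> \<open>From \<open>u\<close>, the integer \<open>p\<close> is reached after
      \<open>k + 1\<close> rotations; stopping \<open>cf_denom \<theta> j\<close> rotations earlier
      leaves an integer minus \<open>cf_error \<theta> j\<close>.\<close>
    define i where "i = k + 1 - cf_denom \<theta> j"
    have i: "i \<le> k" "real i = real (k + 1) - real (cf_denom \<theta> j)"
      using j cf_denom_pos[of j] by (simp_all add: i_def)
    define a where "a = p - int (cf_numer \<theta> j)"
    have floor_eq: "\<lfloor>u + real i * \<theta>\<rfloor> = \<lfloor>u' + real i * \<theta>\<rfloor>"
      using u[OF i(1)] u'[of i] i(1) less by simp
    have a: "u + real i * \<theta> = of_int a - cf_error \<theta> j"
      using up by (simp add: i a_def cf_error_def algebra_simps)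
    have "cf_error \<theta> j \<le> u' - u" if "cf_error \<theta> j < 0"
    proof -
      have "a \<le> \<lfloor>u + real i * \<theta>\<rfloor>" using that a by (simp add: le_floor_iff)
      then have "of_int a \<le> u' + real i * \<theta>" unfolding floor_eq by (simp add: le_floor_iff)
      then show ?thesis using a by linarith
    qed
    moreover have "u' - u \<le> cf_error \<theta> j" if "0 < cf_error \<theta> j"
    proof -
      have "\<lfloor>u + real i * \<theta>\<rfloor> < a" using that a by (simp add: floor_less_iff)
      then have "u' + real i * \<theta> < of_int a" unfolding floor_eq by (simp add: floor_less_iff)
      then show ?thesis using a by linarith
    qed
    ultimately show ?thesis using neq[of j] by (auto simp: less_le)
  qed
  \<comment> \<open>The errors \<open>n\<close> and \<open>n + 1\<close> have opposite signs and so
    give one barrier on each side; the farther one is at distance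
    \<open>\<bar>cf_error \<theta> n\<bar>\<close>.\<close>
  have "\<bar>u' - u\<bar> < \<bar>cf_error \<theta> n\<bar>"
  proof -
    have "cf_denom \<theta> n \<le> k + 1" "cf_denom \<theta> (Suc n) \<le> k + 1"
      using q cf_denom_le_Suc[of n] Suc by simp_all
    note barrier[OF this(1)] barrier[OF this(2)]
    moreover have "cf_error \<theta> n < 0 \<and> 0 < cf_error \<theta> (Suc n) \<or> 0 < cf_error \<theta> n \<and> cf_error \<theta> (Suc n) < 0"
      using cf_error_alternating[of n] by (simp add: mult_less_0_iff) argo
    moreover note abs_cf_error_Suc_less[of n]
    ultimately show ?thesis by linarith
  qed
  moreover have "\<bar>u' - u\<bar> = \<bar>real d * \<theta> - of_int (p' - p)\<bar>"
    unfolding diff by (rule abs_minus_commute)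
  ultimately have "\<not> d < cf_denom \<theta> (Suc n)"
    using best_approximation[OF \<open>0 < d\<close>, of n "p' - p"] by linarith
  then show ?thesis using Suc d by simp
qed

end

section \<open>Tail sums over right special prefixes\<close>

text \<open>Concavity of \<open>x powr (1 - t)\<close>: the increment over an interval of length
  \<open>q\<close> is at least \<open>q\<close> times the derivative at the right end. The case
  \<open>b = q\<close> is separate because Young's inequality is applied to the positive number
  \<open>1 - q / b\<close>.\<close>

lemma powr_diff_ge:
  fixes b q t :: real
  assumes "0 < q" "q \<le> b" "0 < t" "t < 1"
  shows "q * (1 - t) * b powr (- t) \<le> b powr (1 - t) - (b - q) powr (1 - t)"
proof (cases "b = q")
  case True
  have "q * (1 - t) * q powr (- t) = (1 - t) * q powr (1 - t)"
    using assms by (simp add: powr_diff powr_minus field_simps)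
  also have "\<dots> \<le> q powr (1 - t)"
    using assms by (intro mult_left_le_one_le) simp_all
  finally show ?thesis using True assms by simp
next
  case False
  \<comment> \<open>With second base 1, Young's inequality becomes Bernoulli's inequality for the
    exponent \<open>1 - t\<close>.\<close>
  then have "(1 - q / b) powr (1 - t) * 1 powr t \<le> (1 - t) * (1 - q / b) + t * 1"
    using assms by (intro Youngs_inequality_0) (auto simp: field_simps)
  then have *: "(1 - q / b) powr (1 - t) \<le> 1 - (1 - t) * (q / b)"
    by (simp add: algebra_simps)
  have "b - q = b * (1 - q / b)"
    using assms by (simp add: right_diff_distrib)
  then have "(b - q) powr (1 - t) = (b * (1 - q / b)) powr (1 - t)"
    by (rule arg_cong)
  also have "\<dots> = b powr (1 - t) * (1 - q / b) powr (1 - t)"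
    by (rule powr_mult)
  also have "\<dots> \<le> b powr (1 - t) * (1 - (1 - t) * (q / b))"
    using * by (rule mult_left_mono) simp
  also have "\<dots> = b powr (1 - t) - q * (1 - t) * b powr (- t)"
    using assms by (simp add: powr_diff powr_minus field_simps)
  finally show ?thesis by linarith
qed

text \<open>Because of \<open>q \<le> k\<close> the bounds of \<open>powr_diff_ge\<close> telescope down to \<open>0\<close>, and the smallest
  element of \<open>G\<close> needs no separate term.\<close>

lemma sum_powr_separated_le:
  fixes q :: nat and M t :: real
  assumes "finite G" and "0 < q" "0 < t" "t < 1"
    and "\<And>k. k \<in> G \<Longrightarrow> q \<le> k" and "\<And>k. k \<in> G \<Longrightarrow> real k \<le> M"
    and "\<And>k k'. k \<in> G \<Longrightarrow> k' \<in> G \<Longrightarrow> k < k' \<Longrightarrow> k + q \<le> k'"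
  shows "(\<Sum>k\<in>G. real k powr (- t)) \<le> M powr (1 - t) / (real q * (1 - t))"
  using assms(1,5-)
proof (induction G arbitrary: M rule: finite_linorder_max_induct)
  case empty
  then show ?case using \<open>t < 1\<close> by simp
next
  case (insert b A)
  have b: "q \<le> b" "real b \<le> M" using insert.prems by auto
  \<comment> \<open>By separation all of \<open>A\<close> lies at or below \<open>b - q\<close>, so
    the induction hypothesis applies with this bound for \<open>M\<close>; the loss of
    \<open>q\<close> pays for the term of \<open>b\<close>.\<close>
  have "(\<Sum>k\<in>A. real k powr (- t)) \<le> real (b - q) powr (1 - t) / (real q * (1 - t))"
  proof (rule insert.IH)
    fix k assume "k \<in> A"
    then have "k + q \<le> b" using insert by auto
    then show "real k \<le> real (b - q)" by simp
  qed (use insert.prems in auto)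
  also have "\<dots> \<le> (real b powr (1 - t) - real q * (1 - t) * real b powr (- t)) / (real q * (1 - t))"
    using powr_diff_ge[of "real q" "real b" t] b assms(2-4)
    by (intro divide_right_mono) (auto simp: of_nat_diff)
  also have "\<dots> = real b powr (1 - t) / (real q * (1 - t)) - real b powr (- t)"
    using assms(2-4) by (simp add: diff_divide_distrib)
  finally have "(\<Sum>k\<in>A. real k powr (- t)) + real b powr (- t) \<le> real b powr (1 - t) / (real q * (1 - t))"
    by simp
  also have "\<dots> \<le> M powr (1 - t) / (real q * (1 - t))"
    using b assms(2-4) by (intro divide_right_mono powr_mono2) auto
  finally show ?case using insert.hyps by (subst sum.insert) auto
qed

text \<open>The first factor comes from \<open>level_bound\<close> and the sum over one level, the
  second from the geometric series in \<open>sum_cf_denom_powr_le\<close>.\<close>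

definition tail_constant :: "real \<Rightarrow> real \<Rightarrow> real" where
  "tail_constant \<alpha> t = (let s = t - 1 + 1 / \<alpha> in
     2 powr (1 / \<alpha>) / (1 - t) * (sqrt 2 powr s / (1 - sqrt 2 powr (- s))))"

lemma tail_constant_nonneg:
  assumes "1 < \<alpha>" "t < 1" "0 < t - 1 + 1 / \<alpha>"
  shows "0 \<le> tail_constant \<alpha> t"
proof -
  have "sqrt 2 powr (- (t - 1 + 1 / \<alpha>)) < 1" using assms by (intro powr_less_one) auto
  then show ?thesis using assms by (simp add: tail_constant_def Let_def)
qed

context unit_irrational
begin

text \<open>Doubling over two steps. The factor \<open>sqrt 2\<close> on the right covers
  \<open>i = 1\<close>, where only monotonicity is available.\<close>

lemma cf_denom_exponential: "sqrt 2 ^ i * real (cf_denom \<theta> m) \<le> sqrt 2 * real (cf_denom \<theta> (m + i))"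
proof (induction i rule: induct_nat_012)
  case 0
  then show ?case by (simp add: mult_le_cancel_right1)
next
  case 1
  then show ?case using cf_denom_le_Suc[of m] by simp
next
  case (ge2 i)
  have "sqrt 2 ^ Suc (Suc i) * real (cf_denom \<theta> m) = 2 * (sqrt 2 ^ i * real (cf_denom \<theta> m))"
    by simp
  also have "\<dots> \<le> sqrt 2 * real (2 * cf_denom \<theta> (m + i))"
    using ge2(1) by simp
  also have "\<dots> \<le> sqrt 2 * real (cf_denom \<theta> (m + Suc (Suc i)))"
    using cf_denom_double[of "m + i"] by (intro mult_left_mono) (simp_all del: cf_denom.simps)
  finally show ?case .
qed

text \<open>Comparison with the geometric series of ratio \<open>sqrt 2 powr (- s)\<close>; the
  factor \<open>sqrt 2 powr s\<close> is the loss in \<open>cf_denom_exponential\<close>.\<close>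

lemma sum_cf_denom_powr_le:
  fixes s :: real
  assumes "0 < s"
  shows "(\<Sum>i<n. real (cf_denom \<theta> (m + i)) powr (- s))
     \<le> sqrt 2 powr s / (1 - sqrt 2 powr (- s)) * real (cf_denom \<theta> m) powr (- s)"
proof -
  define r where "r = sqrt 2 powr (- s)"
  have r: "0 < r" "r < 1" using assms by (simp_all add: r_def powr_less_one)
  define C where "C = sqrt 2 powr s * real (cf_denom \<theta> m) powr (- s)"
  have "real (cf_denom \<theta> (m + i)) powr (- s) \<le> r ^ i * C" for i
  proof -
    let ?x = "sqrt 2 ^ i * real (cf_denom \<theta> m) / sqrt 2"
    have "?x \<le> real (cf_denom \<theta> (m + i))"
      using cf_denom_exponential[of i m] by (simp add: field_simps)
    then have "real (cf_denom \<theta> (m + i)) powr (- s) \<le> ?x powr (- s)"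
      using assms cf_denom_pos[of m] by (intro powr_mono2') auto
    also have "\<dots> = r ^ i * C"
      by (simp add: powr_divide powr_mult powr_minus powr_powr r_def C_def field_simps
          flip: powr_realpow)
    finally show ?thesis .
  qed
  then have "(\<Sum>i<n. real (cf_denom \<theta> (m + i)) powr (- s)) \<le> (\<Sum>i<n. r ^ i * C)"
    by (intro sum_mono)
  also have "\<dots> = (\<Sum>i<n. r ^ i) * C" by (simp add: sum_distrib_right)
  also have "\<dots> \<le> (1 / (1 - r)) * C"
  proof (rule mult_right_mono)
    have "(\<Sum>i<n. r ^ i) \<le> (\<Sum>i. r ^ i)"
      using r by (intro sum_le_suminf summable_geometric) auto
    then show "(\<Sum>i<n. r ^ i) \<le> 1 / (1 - r)" using r by (simp add: suminf_geometric)
  qed (simp add: C_def)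
  finally show ?thesis by (simp add: r_def C_def)
qed

text \<open>The hypothesis says that the next denominator is at most \<open>2 * B\<close> times the
  \<open>\<alpha>\<close>-th power of the current one. Taking \<open>\<alpha>\<close>-th roots
  bounds the reciprocal of the current denominator by a power of the next.\<close>

lemma level_bound:
  fixes \<alpha> t B :: real
  assumes "1 < \<alpha>" "0 \<le> B"
    and B: "real (cf_digit \<theta> (Suc l)) * real (cf_denom \<theta> l) powr (1 - \<alpha>) \<le> B"
  shows "real (cf_denom \<theta> (Suc l)) powr (1 - t) / real (cf_denom \<theta> l)
     \<le> (2 * B) powr (1 / \<alpha>) * real (cf_denom \<theta> (Suc l)) powr (- (t - 1 + 1 / \<alpha>))"
proof -
  let ?q = "real (cf_denom \<theta> l)" and ?q' = "real (cf_denom \<theta> (Suc l))"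
  have q: "0 < ?q" "0 < ?q'" using cf_denom_pos by simp_all
  have "?q' \<le> real (2 * cf_digit \<theta> (Suc l) * cf_denom \<theta> l)"
    using cf_denom_Suc_le by (simp only: of_nat_le_iff)
  also have "\<dots> = 2 * (real (cf_digit \<theta> (Suc l)) * ?q powr (1 - \<alpha>)) * ?q powr \<alpha>"
    using q by (simp add: powr_diff)
  also have "\<dots> \<le> 2 * B * ?q powr \<alpha>"
    using B by (intro mult_right_mono) auto
  finally have "?q' powr (1 / \<alpha>) \<le> (2 * B * ?q powr \<alpha>) powr (1 / \<alpha>)"
    using assms by (intro powr_mono2) auto
  also have "\<dots> = (2 * B) powr (1 / \<alpha>) * ?q"
    using assms q by (simp add: powr_mult powr_powr)
  finally have "1 / ?q \<le> (2 * B) powr (1 / \<alpha>) * ?q' powr (- (1 / \<alpha>))"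
    using q by (simp add: powr_minus field_simps)
  then have "?q' powr (1 - t) * (1 / ?q) \<le> ?q' powr (1 - t) * ((2 * B) powr (1 / \<alpha>) * ?q' powr (- (1 / \<alpha>)))"
    by (rule mult_left_mono) simp
  also have "\<dots> = (2 * B) powr (1 / \<alpha>) * (?q' powr (1 - t) * ?q' powr (- (1 / \<alpha>)))"
    by simp
  also have "?q' powr (1 - t) * ?q' powr (- (1 / \<alpha>)) = ?q' powr (- (t - 1 + 1 / \<alpha>))"
    by (simp add: algebra_simps flip: powr_add)
  finally show ?thesis by simp
qed

text \<open>The lengths are grouped by the pair of consecutive denominators around them: the gap
  estimate bounds each group, and the groups decay geometrically. Finite \<open>F\<close> suffice,
  because the infinite tail is bounded through its finite partial sums.\<close>

lemma right_special_tail_le: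
  fixes \<alpha> t B :: real
  assumes "1 < \<alpha>" "0 < t" "t < 1" "0 < t - 1 + 1 / \<alpha>" "0 \<le> B"
    and B: "\<And>l. l0 \<le> l \<Longrightarrow> real (cf_digit \<theta> (Suc l)) * real (cf_denom \<theta> l) powr (1 - \<alpha>) \<le> B"
    and N: "0 < N" "cf_denom \<theta> l0 \<le> N"
    and F: "finite F" "\<And>k. k \<in> F \<Longrightarrow> N < k \<and> right_special (sturmian_subshift \<theta>) (word_prefix z k)"
  shows "(\<Sum>k\<in>F. real k powr (- t))
     \<le> tail_constant \<alpha> t * B powr (1 / \<alpha>) * real N powr (- (t - 1 + 1 / \<alpha>))"
proof -
  define s where "s = t - 1 + 1 / \<alpha>"
  have ex: "\<exists>l. k < cf_denom \<theta> (Suc l)" for k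
  proof -
    have "eventually (\<lambda>l. Suc k \<le> cf_denom \<theta> l) sequentially"
      using cf_denom_at_top by (simp add: filterlim_at_top)
    then obtain l where "\<forall>n\<ge>l. Suc k \<le> cf_denom \<theta> n" by (auto simp: eventually_sequentially)
    then have "k < cf_denom \<theta> (Suc l)" by (auto dest!: spec[of _ "Suc l"])
    then show ?thesis ..
  qed
  \<comment> \<open>The index with \<open>cf_denom \<theta> (level k) \<le> k < cf_denom \<theta>
    (Suc (level k))\<close>; the lower bound fails for \<open>k = 0\<close>.\<close>
  define level where "level k = (LEAST l. k < cf_denom \<theta> (Suc l))" for k
  have level_less: "k < cf_denom \<theta> (Suc (level k))" for k
    unfolding level_def by (rule LeastI_ex[OF ex])
  have level_least: "cf_denom \<theta> (Suc l) \<le> k" if "l < level k" for l k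
    using not_less_Least[OF that[unfolded level_def]] by simp
  have level_ge: "cf_denom \<theta> (level k) \<le> k" if "0 < k" for k
    using that level_least[of "level k - 1" k] by (cases "level k") auto
  define m where "m = level N"
  \<comment> \<open>All levels that occur are at least \<open>m\<close>, so the bound
    \<open>B\<close> is available on each of them.\<close>
  have m_l0: "l0 \<le> m"
  proof (rule ccontr)
    assume "\<not> l0 \<le> m"
    then have "cf_denom \<theta> (Suc m) \<le> cf_denom \<theta> l0" by (intro cf_denom_mono) simp
    then show False using N level_less[of N] by (simp add: m_def)
  qed
  have level_F: "m \<le> level k" if "k \<in> F" for k
  proof (rule ccontr)
    assume "\<not> m \<le> level k"
    then have "cf_denom \<theta> (Suc (level k)) \<le> N" by (intro level_least) (simp add: m_def)
    then show False using level_less[of k] F(2)[OF that] by simp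
  qed
  define L where "L = Suc (Max (insert m (level ` F)))"
  have level_L: "level k < L" if "k \<in> F" for k
    unfolding L_def less_Suc_eq_le using F that by (intro Max_ge) auto
  define G where "G l = {k \<in> F. level k = l}" for l
  have "F = (\<Union>l\<in>{m..<L}. G l)"
    using level_F level_L by (auto simp: G_def)
  then have "(\<Sum>k\<in>F. real k powr (- t)) = (\<Sum>l\<in>{m..<L}. \<Sum>k\<in>G l. real k powr (- t))"
    using F by (simp only:) (intro sum.UNION_disjoint, auto simp: G_def)
  also have "\<dots> \<le> (\<Sum>l\<in>{m..<L}. ((2 * B) powr (1 / \<alpha>) / (1 - t)) * real (cf_denom \<theta> (Suc l)) powr (- s))"
  proof (rule sum_mono)
    fix l assume l: "l \<in> {m..<L}"
    have "(\<Sum>k\<in>G l. real k powr (- t)) \<le> real (cf_denom \<theta> (Suc l)) powr (1 - t) / (real (cf_denom \<theta> l) * (1 - t))"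
    proof (rule sum_powr_separated_le)
      show "finite (G l)" using F by (simp add: G_def)
      show "cf_denom \<theta> l \<le> k" if "k \<in> G l" for k
        using that level_ge[of k] F(2)[of k] by (auto simp: G_def)
      then show "k + cf_denom \<theta> l \<le> k'" if "k \<in> G l" "k' \<in> G l" "k < k'" for k k'
        using that F(2) by (intro right_special_gap) (auto simp: G_def le_SucI)
      show "real k \<le> real (cf_denom \<theta> (Suc l))" if "k \<in> G l" for k
        using that level_less[of k] by (auto simp: G_def)
    qed (use assms cf_denom_pos in auto)
    also have "\<dots> = real (cf_denom \<theta> (Suc l)) powr (1 - t) / real (cf_denom \<theta> l) / (1 - t)"
      by simp
    also have "\<dots> \<le> (2 * B) powr (1 / \<alpha>) * real (cf_denom \<theta> (Suc l)) powr (- (t - 1 + 1 / \<alpha>)) / (1 - t)"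
      using l m_l0 assms by (intro divide_right_mono level_bound B) auto
    finally show "(\<Sum>k\<in>G l. real k powr (- t)) \<le> ((2 * B) powr (1 / \<alpha>) / (1 - t)) * real (cf_denom \<theta> (Suc l)) powr (- s)"
      by (simp add: s_def)
  qed
  also have "\<dots> = ((2 * B) powr (1 / \<alpha>) / (1 - t)) * (\<Sum>l\<in>{m..<L}. real (cf_denom \<theta> (Suc l)) powr (- s))"
    by (simp only: sum_distrib_left)
  also have "(\<Sum>l\<in>{m..<L}. real (cf_denom \<theta> (Suc l)) powr (- s)) =
      (\<Sum>i<L - m. real (cf_denom \<theta> (Suc m + i)) powr (- s))"
    by (rule sum.reindex_bij_witness[of _ "\<lambda>i. m + i" "\<lambda>l. l - m"]) auto
  also have "((2 * B) powr (1 / \<alpha>) / (1 - t)) * \<dots> \<le> ((2 * B) powr (1 / \<alpha>) / (1 - t)) *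
      (sqrt 2 powr s / (1 - sqrt 2 powr (- s)) * real (cf_denom \<theta> (Suc m)) powr (- s))"
    using assms by (intro mult_left_mono sum_cf_denom_powr_le) (auto simp: s_def)
  also have "\<dots> = tail_constant \<alpha> t * B powr (1 / \<alpha>) * real (cf_denom \<theta> (Suc m)) powr (- s)"
    using assms by (simp add: tail_constant_def s_def powr_mult)
  \<comment> \<open>The series starts with the first denominator above \<open>N\<close>, and the
    exponent is negative.\<close>
  also have "\<dots> \<le> tail_constant \<alpha> t * B powr (1 / \<alpha>) * real N powr (- s)"
  proof (rule mult_left_mono)
    show "real (cf_denom \<theta> (Suc m)) powr (- s) \<le> real N powr (- s)"
      using N level_less[of N] assms by (intro powr_mono2') (auto simp: m_def s_def)
    show "0 \<le> tail_constant \<alpha> t * B powr (1 / \<alpha>)"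
      using assms by (simp add: tail_constant_nonneg)
  qed
  finally show ?thesis by (simp add: s_def)
qed

end

section \<open>Right special prefixes of the characteristic word\<close>

context unit_irrational
begin

text \<open>Adding \<open>cf_denom \<theta> n\<close> moves the point by an integer plus
  \<open>cf_error \<theta> n\<close>, and by \<open>best_approximation\<close> no integer is closer
  than this error. So none is crossed; landing exactly on one from below is excluded by
  irrationality.\<close>

lemma floor_add_cf_denom:
  assumes "0 < h" "h < cf_denom \<theta> (Suc n)"
  shows "\<lfloor>real (h + cf_denom \<theta> n) * \<theta>\<rfloor> = \<lfloor>real h * \<theta>\<rfloor> + int (cf_numer \<theta> n)"
proof -
  let ?x = "real h * \<theta>" and ?e = "cf_error \<theta> n"
  have eq: "real (h + cf_denom \<theta> n) * \<theta> = ?x + ?e + of_int (int (cf_numer \<theta> n))"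
    by (simp add: cf_error_def algebra_simps)
  have approx: "\<bar>?e\<bar> \<le> \<bar>?x - of_int m\<bar>" for m
    using assms by (rule best_approximation)
  have "\<lfloor>?x + ?e\<rfloor> = \<lfloor>?x\<rfloor>"
  proof (cases "0 < ?e")
    case True
    show ?thesis
    proof (rule ccontr)
      assume "\<lfloor>?x + ?e\<rfloor> \<noteq> \<lfloor>?x\<rfloor>"
      moreover have "\<lfloor>?x\<rfloor> \<le> \<lfloor>?x + ?e\<rfloor>" using True by (intro floor_mono) simp
      ultimately have "\<lfloor>?x\<rfloor> < \<lfloor>?x + ?e\<rfloor>" by simp
      then have "?x < of_int \<lfloor>?x + ?e\<rfloor>" by (simp only: floor_less_iff)
      then have "of_int \<lfloor>?x + ?e\<rfloor> = ?x + ?e"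
        using True approx[of "\<lfloor>?x + ?e\<rfloor>"] of_int_floor_le[of "?x + ?e"] by linarith
      then have "real (h + cf_denom \<theta> n) * \<theta> = of_int (\<lfloor>?x + ?e\<rfloor> + int (cf_numer \<theta> n))"
        unfolding eq of_int_add by linarith
      then show False using no_integer_multiple[of "h + cf_denom \<theta> n"] assms by blast
    qed
  next
    case False
    then have "of_int \<lfloor>?x\<rfloor> \<le> ?x + ?e"
      using approx[of "\<lfloor>?x\<rfloor>"] of_int_floor_le[of ?x] by linarith
    moreover have "?x + ?e < of_int \<lfloor>?x\<rfloor> + 1"
      using False by linarith
    ultimately show ?thesis by (intro floor_unique) auto
  qed
  then show ?thesis unfolding eq by (simp only: floor_add_int[symmetric])
qed

text \<open>Only the multiple before each addition must stay below
  \<open>cf_denom \<theta> (Suc n)\<close>, so the final one may exceed it by nearly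
  \<open>cf_denom \<theta> n\<close>.\<close>

lemma floor_add_mult_cf_denom:
  assumes "0 < h" "h + i * cf_denom \<theta> n < cf_denom \<theta> (Suc n) + cf_denom \<theta> n"
  shows "\<lfloor>real (h + i * cf_denom \<theta> n) * \<theta>\<rfloor> = \<lfloor>real h * \<theta>\<rfloor> + int (i * cf_numer \<theta> n)"
  using assms(2)
proof (induction i)
  case (Suc i)
  have "\<lfloor>real (h + i * cf_denom \<theta> n + cf_denom \<theta> n) * \<theta>\<rfloor> =
      \<lfloor>real (h + i * cf_denom \<theta> n) * \<theta>\<rfloor> + int (cf_numer \<theta> n)"
    using Suc.prems assms(1) by (intro floor_add_cf_denom) simp_all
  then show ?case using Suc by (simp add: add_ac)
qed simp

text \<open>The range in \<open>floor_add_cf_denom\<close> is sharp: at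
  \<open>cf_denom \<theta> (Suc n)\<close> the point is off an integer by an error of smaller
  modulus and opposite sign, so adding \<open>cf_error \<theta> n\<close> crosses that
  integer.\<close>

lemma floor_cf_denom_add_cf_denom:
  "\<lfloor>real (cf_denom \<theta> (Suc n) + cf_denom \<theta> n) * \<theta>\<rfloor>
     \<noteq> \<lfloor>real (cf_denom \<theta> (Suc n)) * \<theta>\<rfloor> + int (cf_numer \<theta> n)"
proof -
  let ?e = "cf_error \<theta> n" and ?e' = "cf_error \<theta> (Suc n)"
  define p where "p = int (cf_numer \<theta> (Suc n))"
  have eq: "real (cf_denom \<theta> (Suc n) + cf_denom \<theta> n) * \<theta> = (of_int p + ?e' + ?e) + of_int (int (cf_numer \<theta> n))"
    "real (cf_denom \<theta> (Suc n)) * \<theta> = of_int p + ?e'"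
    by (simp_all add: p_def cf_error_def algebra_simps del: cf_denom.simps cf_numer.simps)
  have "?e < 0 \<and> 0 < ?e' \<or> 0 < ?e \<and> ?e' < 0"
    using cf_error_alternating[of n] by (simp add: mult_less_0_iff) argo
  then have "\<lfloor>of_int p + ?e' + ?e\<rfloor> \<noteq> \<lfloor>of_int p + ?e'\<rfloor>"
  proof
    assume *: "?e < 0 \<and> 0 < ?e'"
    then have "\<lfloor>of_int p + ?e' + ?e\<rfloor> < p"
      using abs_cf_error_Suc_less[of n] by (simp add: floor_less_iff)
    moreover have "p \<le> \<lfloor>of_int p + ?e'\<rfloor>" using * by (simp add: le_floor_iff)
    ultimately show ?thesis by linarith
  next
    assume *: "0 < ?e \<and> ?e' < 0"
    then have "p \<le> \<lfloor>of_int p + ?e' + ?e\<rfloor>"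
      using abs_cf_error_Suc_less[of n] by (simp add: le_floor_iff)
    moreover have "\<lfloor>of_int p + ?e'\<rfloor> < p" using * by (simp add: floor_less_iff)
    ultimately show ?thesis by linarith
  qed
  then show ?thesis unfolding eq by (simp only: floor_add_int[symmetric])
qed

lemma sturmian_word_shift_agree:
  assumes "j + i * cf_denom \<theta> n + 2 < cf_denom \<theta> (Suc n)"
  shows "sturmian_word \<theta> (Suc i * cf_denom \<theta> n + j) = sturmian_word \<theta> j"
  using floor_add_mult_cf_denom[of "j + 2" "Suc i" n] floor_add_mult_cf_denom[of "j + 1" "Suc i" n] assms
  by (simp add: sturmian_word_eq_floor add_ac)

text \<open>Of the two multiples that determine the letter, \<open>j + 2\<close> passes through
  \<open>cf_denom \<theta> (Suc n)\<close> and picks up the exceptional floor, whereas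
  \<open>j + 1\<close> stays in the regular range.\<close>

lemma sturmian_word_shift_differ:
  assumes "j + i * cf_denom \<theta> n + 2 = cf_denom \<theta> (Suc n)"
  shows "sturmian_word \<theta> (Suc i * cf_denom \<theta> n + j) \<noteq> sturmian_word \<theta> j"
proof -
  have eq: "j + 2 + i * cf_denom \<theta> n = cf_denom \<theta> (Suc n)"
    "j + 2 + Suc i * cf_denom \<theta> n = cf_denom \<theta> (Suc n) + cf_denom \<theta> n"
    using assms by simp_all
  have "\<lfloor>real (j + 2 + i * cf_denom \<theta> n) * \<theta>\<rfloor> = \<lfloor>real (j + 2) * \<theta>\<rfloor> + int (i * cf_numer \<theta> n)"
    using assms cf_denom_pos[of n] by (intro floor_add_mult_cf_denom) auto
  then have "\<lfloor>real (cf_denom \<theta> (Suc n)) * \<theta>\<rfloor> + int (cf_numer \<theta> n) =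
      \<lfloor>real (j + 2) * \<theta>\<rfloor> + int (Suc i * cf_numer \<theta> n)"
    unfolding eq by simp
  then have "\<lfloor>real (j + 2 + Suc i * cf_denom \<theta> n) * \<theta>\<rfloor> \<noteq>
      \<lfloor>real (j + 2) * \<theta>\<rfloor> + int (Suc i * cf_numer \<theta> n)"
    using floor_cf_denom_add_cf_denom[of n] unfolding eq by metis
  moreover have "\<lfloor>real (j + 1 + Suc i * cf_denom \<theta> n) * \<theta>\<rfloor> = \<lfloor>real (j + 1) * \<theta>\<rfloor> + int (Suc i * cf_numer \<theta> n)"
    using assms by (intro floor_add_mult_cf_denom) auto
  ultimately show ?thesis
    by (simp add: sturmian_word_eq_floor add_ac)
qed

text \<open>The prefix occurs at position 0 and again at \<open>Suc i * cf_denom \<theta> n\<close>,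
  followed by different letters.\<close>

lemma right_special_sturmian_word_prefix:
  assumes "k + i * cf_denom \<theta> n + 2 = cf_denom \<theta> (Suc n)"
  shows "right_special (sturmian_subshift \<theta>) (word_prefix (sturmian_word \<theta>) k)"
proof -
  let ?c = "sturmian_word \<theta>" and ?m = "Suc i * cf_denom \<theta> n"
  have ext: "word_prefix ?c k @ [?c (0 + k)] \<in> language (sturmian_subshift \<theta>)"
    unfolding extension_in_language_iff by (intro exI[of _ 0]) simp
  have ext': "word_prefix ?c k @ [?c (?m + k)] \<in> language (sturmian_subshift \<theta>)"
    unfolding extension_in_language_iff
  proof (intro exI[of _ ?m] conjI allI impI)
    fix j assume "j < k"
    then show "?c j = ?c (?m + j)"
      using assms by (intro sturmian_word_shift_agree[symmetric]) simp
  qed simp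
  have "?c (?m + k) \<noteq> ?c k" using assms by (rule sturmian_word_shift_differ)
  then have "{?c (0 + k), ?c (?m + k)} = {0, 1}"
    using sturmian_word_letters[of k] sturmian_word_letters[of "?m + k"] by auto
  then have "word_prefix ?c k @ [0] \<in> language (sturmian_subshift \<theta>)"
      "word_prefix ?c k @ [1] \<in> language (sturmian_subshift \<theta>)"
    using ext ext' by (metis insert_iff empty_iff)+
  moreover have "word_prefix ?c k \<in> language (sturmian_subshift \<theta>)"
    unfolding language_sturmian_subshift by (intro exI[of _ 0]) (simp add: word_prefix_def)
  ultimately show ?thesis by (simp add: right_special_def)
qed

end

section \<open>Bounds for the Hoelder quotient\<close>

lemma common_prefix_length_eq:
  assumes "\<And>i. i < n \<Longrightarrow> v i = w i" "v n \<noteq> w n"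
  shows "common_prefix_length v w = max 1 n"
proof -
  have "(GREATEST n. word_prefix v n = word_prefix w n) = n"
  proof (rule Greatest_equality)
    show "word_prefix v n = word_prefix w n" using assms by (simp add: word_prefix_def)
    fix m assume "word_prefix v m = word_prefix w m"
    then show "m \<le> n" using assms(2) by (force simp: word_prefix_def not_le[symmetric])
  qed
  then show ?thesis by (simp add: common_prefix_length_def Let_def)
qed

lemma common_prefix_length_pos: "0 < common_prefix_length v w"
  by (simp add: common_prefix_length_def Let_def)

lemma eventually_punctured_nhds:
  "eventually P (punctured_nhds X d w) \<longleftrightarrow> (\<exists>\<epsilon>>0. \<forall>v\<in>X. v \<noteq> w \<longrightarrow> d w v < \<epsilon> \<longrightarrow> P v)"
proof -
  have "eventually P (punctured_nhds X d w) \<longleftrightarrow>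
      (\<exists>\<epsilon>\<in>{0<..}. eventually P (principal {v \<in> X. v \<noteq> w \<and> d w v < \<epsilon>}))"
    unfolding punctured_nhds_def
  proof (rule eventually_INF_base)
    fix a b :: real assume "a \<in> {0<..}" "b \<in> {0<..}"
    then show "\<exists>x\<in>{0<..}. principal {v \<in> X. v \<noteq> w \<and> d w v < x} \<le>
        inf (principal {v \<in> X. v \<noteq> w \<and> d w v < a}) (principal {v \<in> X. v \<noteq> w \<and> d w v < b})"
      by (intro bexI[of _ "min a b"]) auto
  qed auto
  then show ?thesis by (auto simp: eventually_principal)
qed

lemma real_powr_neg_tendsto_0: "0 < t \<Longrightarrow> (\<lambda>n. real n powr (- t)) \<longlonglongrightarrow> 0"
  by (rule tendsto_neg_powr[OF _ filterlim_real_sequentially]) simp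

text \<open>On distinct words the ultrametric is a decreasing null sequence evaluated at the common
  prefix length, so small balls amount to lower bounds on that length.\<close>

lemma eventually_punctured_nhds_ultrametric:
  assumes "0 < t" and \<delta>: "\<delta> = (\<lambda>n. real n powr (- t))"
  shows "eventually P (punctured_nhds X (ultrametric \<delta>) w) \<longleftrightarrow>
    (\<exists>N. \<forall>v\<in>X. v \<noteq> w \<longrightarrow> N \<le> common_prefix_length w v \<longrightarrow> P v)"
  unfolding eventually_punctured_nhds
proof
  assume "\<exists>\<epsilon>>0. \<forall>v\<in>X. v \<noteq> w \<longrightarrow> ultrametric \<delta> w v < \<epsilon> \<longrightarrow> P v"
  then obtain \<epsilon> where "0 < \<epsilon>" and P: "\<And>v. v \<in> X \<Longrightarrow> v \<noteq> w \<Longrightarrow> ultrametric \<delta> w v < \<epsilon> \<Longrightarrow> P v"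
    by blast
  then have "eventually (\<lambda>n. \<delta> n < \<epsilon>) sequentially"
    unfolding \<delta> using real_powr_neg_tendsto_0[OF \<open>0 < t\<close>] by (simp add: order_tendsto_iff)
  then obtain N where "\<And>n. N \<le> n \<Longrightarrow> \<delta> n < \<epsilon>" by (auto simp: eventually_sequentially)
  then show "\<exists>N. \<forall>v\<in>X. v \<noteq> w \<longrightarrow> N \<le> common_prefix_length w v \<longrightarrow> P v"
    using P by (intro exI[of _ N]) (auto simp: ultrametric_def)
next
  assume "\<exists>N. \<forall>v\<in>X. v \<noteq> w \<longrightarrow> N \<le> common_prefix_length w v \<longrightarrow> P v"
  then obtain N where P: "\<And>v. v \<in> X \<Longrightarrow> v \<noteq> w \<Longrightarrow> N \<le> common_prefix_length w v \<Longrightarrow> P v"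
    by blast
  \<comment> \<open>The radius uses \<open>Suc N\<close> since \<open>0 powr (- t) = 0\<close>, so
    that \<open>\<delta> 0\<close> would not be a positive radius.\<close>
  have "N \<le> common_prefix_length w v" if "v \<noteq> w" "ultrametric \<delta> w v < \<delta> (Suc N)" for v
  proof (rule ccontr)
    assume "\<not> N \<le> common_prefix_length w v"
    then have "\<delta> (Suc N) \<le> \<delta> (common_prefix_length w v)"
      unfolding \<delta> using \<open>0 < t\<close> common_prefix_length_pos[of w v] by (intro powr_mono2') auto
    then show False using that by (simp add: ultrametric_def)
  qed
  then show "\<exists>\<epsilon>>0. \<forall>v\<in>X. v \<noteq> w \<longrightarrow> ultrametric \<delta> w v < \<epsilon> \<longrightarrow> P v"
    using P by (intro exI[of _ "\<delta> (Suc N)"]) (auto simp: \<delta>)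
qed

text \<open>The critical exponent is the one for which
  \<open>t * critical_exponent \<alpha> t\<close> is the decay rate
  \<open>t - 1 + 1 / \<alpha>\<close> of the tails.\<close>

lemma ultrametric_powr_critical_exponent:
  assumes "v \<noteq> w" "0 < t" "1 < \<alpha>"
  shows "ultrametric (\<lambda>n. real n powr (- t)) w v powr critical_exponent \<alpha> t
     = real (common_prefix_length w v) powr (- (t - 1 + 1 / \<alpha>))"
proof -
  have "t * critical_exponent \<alpha> t = t - 1 + 1 / \<alpha>"
    using assms by (simp add: critical_exponent_def field_simps)
  then show ?thesis using assms by (auto simp: ultrametric_def powr_powr)
qed

lemma spectral_metric_ge:
  assumes "v \<noteq> w" "finite F" "\<And>n. 0 \<le> \<delta> n"
    and "\<And>j. j \<in> F \<Longrightarrow> common_prefix_length w v < j \<and> right_special X (word_prefix w j)"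
  shows "ennreal (\<Sum>j\<in>F. \<delta> j) \<le> spectral_metric X \<delta> w v"
proof -
  let ?N = "common_prefix_length w v"
  have "ennreal (\<Sum>j\<in>F. \<delta> j) = (\<Sum>j\<in>F. ennreal (special_indicator X j w * \<delta> j))"
    using assms(3,4) by (subst sum_ennreal[symmetric]) (auto simp: special_indicator_def)
  also have "\<dots> \<le> (\<Sum>\<^sub>\<infinity>n\<in>{?N<..}. ennreal (special_indicator X n w * \<delta> n))"
    unfolding infsum_finite[OF assms(2), symmetric]
    by (intro infsum_mono_neutral nonneg_summable_on_complete) (use assms(4) in auto)
  also have "\<dots> \<le> ennreal (\<delta> ?N) + (\<Sum>\<^sub>\<infinity>n\<in>{?N<..}. ennreal (special_indicator X n w * \<delta> n))
         + (\<Sum>\<^sub>\<infinity>n\<in>{?N<..}. ennreal (special_indicator X n v * \<delta> n))"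
    by (simp add: add_increasing add_increasing2)
  finally show ?thesis using assms(1) by (auto simp: spectral_metric_def)
qed

text \<open>With \<open>s = t - 1 + 1 / \<alpha>\<close> the first factor is
  \<open>(1 / 4) * (1 / 4) powr s\<close>, from \<open>a / 4 \<le> b\<close> and
  \<open>q' \<le> 4 * k\<close> in the next estimate of a sum; the second comes from
  \<open>q' \<le> 2 * a * q\<close>.\<close>

definition growth_constant :: "real \<Rightarrow> real \<Rightarrow> real" where
  "growth_constant \<alpha> t = 4 powr (- t - 1 / \<alpha>) * 2 powr (1 / \<alpha> - 1)"

context unit_irrational
begin

lemma special_indicator_infsum_le:
  fixes \<alpha> t B :: real
  assumes "1 < \<alpha>" "0 < t" "t < 1" "0 < t - 1 + 1 / \<alpha>" "0 \<le> B"
    and B: "\<And>l. l0 \<le> l \<Longrightarrow> real (cf_digit \<theta> (Suc l)) * real (cf_denom \<theta> l) powr (1 - \<alpha>) \<le> B"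
    and N: "0 < N" "cf_denom \<theta> l0 \<le> N"
  shows "(\<Sum>\<^sub>\<infinity>n\<in>{N<..}. ennreal (special_indicator (sturmian_subshift \<theta>) n z * real n powr (- t)))
    \<le> ennreal (tail_constant \<alpha> t * B powr (1 / \<alpha>) * real N powr (- (t - 1 + 1 / \<alpha>)))"
proof (rule infsum_le_finite_sums)
  fix F :: "nat set" assume F: "finite F" "F \<subseteq> {N<..}"
  let ?X = "sturmian_subshift \<theta>"
  have "(\<Sum>n\<in>F. special_indicator ?X n z * real n powr (- t)) =
      (\<Sum>n\<in>{n\<in>F. right_special ?X (word_prefix z n)}. real n powr (- t))"
    using F by (simp add: special_indicator_def sum.If_cases if_distrib[of "\<lambda>x. x * _"] Collect_conj_eq
        flip: Int_def cong: if_cong)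
  also have "\<dots> \<le> tail_constant \<alpha> t * B powr (1 / \<alpha>) * real N powr (- (t - 1 + 1 / \<alpha>))"
    using F by (intro right_special_tail_le[OF assms(1-5) B N]) auto
  finally show "(\<Sum>n\<in>F. ennreal (special_indicator ?X n z * real n powr (- t))) \<le>
      ennreal (tail_constant \<alpha> t * B powr (1 / \<alpha>) * real N powr (- (t - 1 + 1 / \<alpha>)))"
    by (subst sum_ennreal) (auto simp: special_indicator_def intro: ennreal_leI)
qed (rule nonneg_summable_on_complete, simp)

text \<open>As \<open>s < t\<close>, the summand \<open>\<delta> N\<close> is negligible against
  \<open>N powr (- s)\<close> and accounts for \<open>e\<close>; the two tails account for the rest.
  The bound does not depend on \<open>w\<close>, so it passes to the supremum.\<close>

lemma holder_psi_at_le: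
  fixes \<alpha> t B e :: real
  defines "\<delta> \<equiv> \<lambda>n. real n powr (- t)" and "X \<equiv> sturmian_subshift \<theta>"
  assumes "1 < \<alpha>" "0 < t" "t < 1" "0 < t - 1 + 1 / \<alpha>" "0 \<le> B" "0 < e"
    and B: "eventually (\<lambda>n. real (cf_digit \<theta> n) * real (cf_denom \<theta> (n - 1)) powr (1 - \<alpha>) \<le> B) sequentially"
  shows "holder_psi_at X (spectral_metric X \<delta>) (ultrametric \<delta>) (critical_exponent \<alpha> t) w
    \<le> ennreal (e + 2 * tail_constant \<alpha> t * B powr (1 / \<alpha>))"
proof -
  define s where "s = t - 1 + 1 / \<alpha>"
  define K where "K = tail_constant \<alpha> t * B powr (1 / \<alpha>)"
  have K: "0 \<le> K" using assms by (simp add: K_def tail_constant_nonneg)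
  obtain l0 where l0: "\<And>n. l0 \<le> n \<Longrightarrow> real (cf_digit \<theta> n) * real (cf_denom \<theta> (n - 1)) powr (1 - \<alpha>) \<le> B"
    using B by (auto simp: eventually_sequentially)
  then have l0': "real (cf_digit \<theta> (Suc l)) * real (cf_denom \<theta> l) powr (1 - \<alpha>) \<le> B" if "l0 \<le> l" for l
    using that by (metis diff_Suc_1 le_SucI)
  have "1 / \<alpha> < 1" using assms by simp
  then have "(\<lambda>n. real n powr (- (t - s))) \<longlonglongrightarrow> 0"
    by (intro real_powr_neg_tendsto_0) (simp add: s_def)
  then have "eventually (\<lambda>n. real n powr (- (t - s)) < e) sequentially"
    using assms by (simp add: order_tendsto_iff)
  then obtain N0 where N0: "\<And>n. N0 \<le> n \<Longrightarrow> real n powr (- (t - s)) < e"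
    by (auto simp: eventually_sequentially)
  have bound: "spectral_metric X \<delta> w v / ennreal (ultrametric \<delta> w v powr critical_exponent \<alpha> t)
      \<le> ennreal (e + 2 * K)"
    if "v \<noteq> w" and le: "max N0 (cf_denom \<theta> l0) \<le> common_prefix_length w v" for v
  proof -
    define N where "N = common_prefix_length w v"
    have N: "0 < N" "N0 \<le> N" "cf_denom \<theta> l0 \<le> N"
      using le common_prefix_length_pos by (simp_all add: N_def)
    have tail: "(\<Sum>\<^sub>\<infinity>n\<in>{N<..}. ennreal (special_indicator X n z * \<delta> n)) \<le> ennreal (K * real N powr (- s))" for z
      unfolding \<delta>_def X_def K_def s_def
      by (rule special_indicator_infsum_le) (use assms l0' N in auto)
    have "spectral_metric X \<delta> w v = ennreal (\<delta> N)
       + (\<Sum>\<^sub>\<infinity>n\<in>{N<..}. ennreal (special_indicator X n w * \<delta> n))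
       + (\<Sum>\<^sub>\<infinity>n\<in>{N<..}. ennreal (special_indicator X n v * \<delta> n))"
      using that(1) by (auto simp: spectral_metric_def N_def)
    also have "\<dots> \<le> ennreal (\<delta> N) + ennreal (K * real N powr (- s)) + ennreal (K * real N powr (- s))"
      by (intro add_mono tail order_refl)
    also have "\<dots> = ennreal (\<delta> N + 2 * K * real N powr (- s))"
      using K by (simp add: \<delta>_def flip: ennreal_plus)
    finally have "spectral_metric X \<delta> w v / ennreal (real N powr (- s)) \<le>
        ennreal (\<delta> N + 2 * K * real N powr (- s)) / ennreal (real N powr (- s))"
      by (rule divide_right_mono_ennreal)
    also have "\<dots> = ennreal ((\<delta> N + 2 * K * real N powr (- s)) / real N powr (- s))"
      using N K by (intro divide_ennreal) (auto simp: \<delta>_def)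
    also have "(\<delta> N + 2 * K * real N powr (- s)) / real N powr (- s) = real N powr (- (t - s)) + 2 * K"
      using N by (simp add: \<delta>_def add_divide_distrib flip: powr_diff)
    also have "ennreal \<dots> \<le> ennreal (e + 2 * K)"
      using N0[OF N(2)] by (intro ennreal_leI) simp
    finally show ?thesis
      using ultrametric_powr_critical_exponent[OF that(1) \<open>0 < t\<close> \<open>1 < \<alpha>\<close>]
      by (simp add: \<delta>_def N_def s_def)
  qed
  have "eventually (\<lambda>v. spectral_metric X \<delta> w v / ennreal (ultrametric \<delta> w v powr critical_exponent \<alpha> t)
      \<le> ennreal (e + 2 * K)) (punctured_nhds X (ultrametric \<delta>) w)"
    unfolding eventually_punctured_nhds_ultrametric[OF \<open>0 < t\<close> meta_eq_to_obj_eq[OF \<delta>_def]]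
    using bound by blast
  then show ?thesis
    unfolding holder_psi_at_def by (simp add: Limsup_bounded K_def mult.assoc)
qed

text \<open>The right special prefixes of \<open>c\<close> of the lengths \<open>pos 0 > pos 1 > \<dots>\<close> form an arithmetic
  progression. Starting it halfway, at \<open>pos b\<close> with \<open>b = a div 2\<close>, makes all lengths comparable to
  \<open>q'\<close> and keeps half of the terms.\<close>

lemma sum_sturmian_word_special_ge:
  fixes \<alpha> t :: real
  defines "X \<equiv> sturmian_subshift \<theta>" and "c \<equiv> sturmian_word \<theta>"
  assumes "1 < \<alpha>" "0 < t" "0 < t - 1 + 1 / \<alpha>"
    and digit: "9 \<le> cf_digit \<theta> (Suc n)" "4 * N \<le> cf_digit \<theta> (Suc n)"
  obtains v k F where "v \<in> X" "v \<noteq> c" "common_prefix_length c v = k" "N \<le> k" "0 < k"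
    "finite F" "\<And>j. j \<in> F \<Longrightarrow> k < j \<and> right_special X (word_prefix c j)"
    "growth_constant \<alpha> t * (real (cf_digit \<theta> (Suc n)) * real (cf_denom \<theta> n) powr (1 - \<alpha>)) powr (1 / \<alpha>)
       \<le> (\<Sum>j\<in>F. real j powr (- t)) * real k powr (t - 1 + 1 / \<alpha>)"
proof -
  define a q q' s where "a = cf_digit \<theta> (Suc n)" and "q = cf_denom \<theta> n" and "q' = cf_denom \<theta> (Suc n)"
    and "s = t - 1 + 1 / \<alpha>"
  have q: "0 < q" "0 < q'" by (simp_all only: q_def q'_def cf_denom_pos)
  have q'_le: "q' \<le> 2 * a * q" unfolding q'_def a_def q_def by (rule cf_denom_Suc_le)
  have q'_ge: "a * q \<le> q'" by (cases n) (simp_all add: q'_def a_def q_def)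
  have "a \<le> a * q" using q by simp
  then have a_q': "a \<le> q'" using q'_ge by linarith
  define b where "b = a div 2"
  have "2 * (b * q) \<le> a * q"
    unfolding b_def mult.assoc[symmetric] by (intro mult_right_mono) auto
  then have bq: "2 * (b * q) \<le> q'" using q'_ge by linarith
  \<comment> \<open>The subtraction is on natural numbers; the next fact shows that it is not
    truncated for \<open>i \<le> b\<close>.\<close>
  define pos where "pos i = q' - i * q - 2" for i
  have pos: "pos i + i * q + 2 = q'" "i * q \<le> b * q" if "i \<le> b" for i
  proof -
    show "i * q \<le> b * q" using that by simp
    then show "pos i + i * q + 2 = q'"
      using bq a_q' digit unfolding pos_def a_def by linarith
  qed
  define k where "k = pos b"
  \<comment> \<open>From \<open>2 * (b * q) \<le> q'\<close> follows
    \<open>4 * k \<ge> 2 * q' - 8\<close>, and \<open>q' \<ge> a \<ge> 9\<close> absorbs the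
    8.\<close>
  have k_ge: "q' \<le> 4 * k"
    using pos[of b] bq a_q' digit unfolding k_def a_def by linarith
  have pos_less: "pos j < pos i" if "i < j" "j \<le> b" for i j
  proof -
    have "i * q < j * q" using that q by simp
    then show ?thesis using pos(1)[of i] pos(1)[of j] that by linarith
  qed
  define F where "F = pos ` {..<b}"
  \<comment> \<open>This shift first departs from \<open>c\<close> at position \<open>pos b\<close>,
    so every length in \<open>F\<close> lies beyond the common prefix.\<close>
  define v where "v = (shift ^^ (Suc b * q)) c"
  have agree: "c i = v i" if "i < k" for i
    using that pos[of b] sturmian_word_shift_agree[of i b n]
    by (simp add: v_def c_def funpow_shift q_def q'_def k_def del: cf_denom.simps)
  have differ: "c k \<noteq> v k"
    using pos[of b] sturmian_word_shift_differ[of k b n]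
    by (simp add: v_def c_def funpow_shift q_def q'_def k_def del: cf_denom.simps)
  have k: "0 < k" using k_ge q by simp
  have inj: "inj_on pos {..<b}"
  proof (rule linorder_inj_onI)
    fix x y assume "x < y" "x \<in> {..<b}" "y \<in> {..<b}"
    then show "pos x \<noteq> pos y" using pos_less[of x y] by simp
  qed auto
  have "real a / 4 * real q' powr (- t) \<le> real b * real q' powr (- t)"
    using digit by (intro mult_right_mono) (auto simp: a_def b_def)
  also have "\<dots> = (\<Sum>i<b. real q' powr (- t))" by simp
  also have "\<dots> \<le> (\<Sum>i<b. real (pos i) powr (- t))"
  proof (intro sum_mono powr_mono2')
    fix i assume "i \<in> {..<b}"
    then show "0 < real (pos i)" "real (pos i) \<le> real q'"
      using pos(1)[of i] pos_less[of i b] by simp_all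
  qed (use \<open>0 < t\<close> in simp)
  also have "\<dots> = (\<Sum>j\<in>F. real j powr (- t))"
    unfolding F_def by (simp add: sum.reindex[OF inj])
  finally have sum_ge: "real a / 4 * real q' powr (- t) \<le> (\<Sum>j\<in>F. real j powr (- t))" .
  have "growth_constant \<alpha> t * (real a * real q powr (1 - \<alpha>)) powr (1 / \<alpha>) =
      (1 / 4) * real a * (2 * real a * real q) powr (1 / \<alpha> - 1) * (1 / 4) powr s"
  proof -
    have a: "0 < real a" using digit by (simp add: a_def)
    have "real a powr (1 / \<alpha>) = real a * real a powr (1 / \<alpha> - 1)"
      using a by (simp add: powr_diff)
    moreover have "(1 - \<alpha>) * (1 / \<alpha>) = 1 / \<alpha> - 1" using assms by (simp add: field_simps)
    moreover have "4 powr (- t - 1 / \<alpha>) = (1 / 4) * (1 / 4 :: real) powr s"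
      by (simp add: powr_divide s_def powr_diff powr_add powr_minus field_simps)
    ultimately show ?thesis
      using a q by (simp add: growth_constant_def powr_mult powr_powr)
  qed
  \<comment> \<open>The exponent \<open>1 / \<alpha> - 1\<close> is negative, so the upper bound on
    \<open>q'\<close> turns into a lower bound for its power.\<close>
  also have "\<dots> \<le> (1 / 4) * real a * real q' powr (1 / \<alpha> - 1) * (1 / 4) powr s"
  proof (intro mult_left_mono mult_right_mono powr_mono2')
    show "real q' \<le> 2 * real a * real q" using q'_le by (metis of_nat_le_iff of_nat_mult of_nat_numeral)
  qed (use assms q in auto)
  also have "\<dots> = real a / 4 * real q' powr (- t) * (real q' / 4) powr s"
  proof -
    have "1 / \<alpha> - 1 = - t + s" by (simp add: s_def)
    then have "real q' powr (1 / \<alpha> - 1) = real q' powr (- t) * real q' powr s"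
      by (simp only: powr_add)
    then show ?thesis by (simp add: powr_divide)
  qed
  also have "\<dots> \<le> (\<Sum>j\<in>F. real j powr (- t)) * real k powr s"
    using k_ge assms by (intro mult_mono sum_ge powr_mono2) (auto simp: s_def sum_nonneg)
  finally show thesis
  proof (intro that[of v k F], goal_cases)
    case 1
    show ?case unfolding v_def X_def c_def by (rule shift_sturmian_word_in_subshift)
  next
    case 2
    show ?case using differ by auto
  next
    case 3
    show ?case using common_prefix_length_eq[of k c v] agree differ k by simp
  next
    case 4
    show ?case using k_ge a_q' digit by (simp add: a_def)
  next
    case 5
    show ?case by (rule k)
  next
    case 6
    show ?case by (simp add: F_def)
  next
    case (7 j)
    then obtain i where i: "j = pos i" "i < b" by (auto simp: F_def)
    then show ?case
      using pos_less[of i b] pos[of i] right_special_sturmian_word_prefix[of "pos i" i n]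
      by (simp add: X_def c_def k_def q_def q'_def del: cf_denom.simps)
  next
    case 8
    then show ?case by (simp add: a_def q_def s_def)
  qed
qed

text \<open>Every eventual property \<open>P\<close> must contain a word with a large quotient. The
  powers of the denominators tend to 0, so infinitely many values above \<open>B\<close> force large
  digits, and these yield such words with arbitrarily long common prefixes.\<close>

lemma holder_psi_at_ge:
  fixes \<alpha> t B :: real
  defines "\<delta> \<equiv> \<lambda>n. real n powr (- t)" and "X \<equiv> sturmian_subshift \<theta>"
  assumes "1 < \<alpha>" "0 < t" "0 < t - 1 + 1 / \<alpha>" "0 < B"
    and B: "frequently (\<lambda>n. B \<le> real (cf_digit \<theta> n) * real (cf_denom \<theta> (n - 1)) powr (1 - \<alpha>)) sequentially"
  shows "ennreal (growth_constant \<alpha> t * B powr (1 / \<alpha>)) \<le>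
    holder_psi_at X (spectral_metric X \<delta>) (ultrametric \<delta>) (critical_exponent \<alpha> t) (sturmian_word \<theta>)"
  unfolding holder_psi_at_def
proof (rule Limsup_greatest)
  let ?c = "sturmian_word \<theta>"
  fix P assume "eventually P (punctured_nhds X (ultrametric \<delta>) ?c)"
  then obtain N where P: "\<And>v. v \<in> X \<Longrightarrow> v \<noteq> ?c \<Longrightarrow> N \<le> common_prefix_length ?c v \<Longrightarrow> P v"
    using \<open>0 < t\<close> by (subst (asm) eventually_punctured_nhds_ultrametric) (auto simp: \<delta>_def)
  define M where "M = max 9 (4 * N)"
  have "filterlim (\<lambda>n. real (cf_denom \<theta> n)) at_top sequentially"
    by (rule filterlim_compose[OF filterlim_real_sequentially cf_denom_at_top])
  then have "filterlim (\<lambda>n. real (cf_denom \<theta> n) powr (1 - \<alpha>)) (nhds 0) sequentially"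
    using \<open>1 < \<alpha>\<close> by (intro tendsto_neg_powr) auto
  \<comment> \<open>The threshold is chosen so that a product of at least \<open>B\<close> forces
    the digit to be at least \<open>M + 1\<close>.\<close>
  then have "eventually (\<lambda>n. real (cf_denom \<theta> n) powr (1 - \<alpha>) < B / (real M + 1)) sequentially"
    using \<open>0 < B\<close> by (intro order_tendstoD) auto
  then have "eventually (\<lambda>n. real (cf_denom \<theta> (n - 1)) powr (1 - \<alpha>) < B / (real M + 1)) sequentially"
    by (rule eventually_compose_filterlim) (rule filterlim_minus_const_nat_at_top)
  moreover have "eventually (\<lambda>n. 0 < n) sequentially" by (rule eventually_gt_at_top)
  ultimately have "frequently (\<lambda>n. B \<le> real (cf_digit \<theta> n) * real (cf_denom \<theta> (n - 1)) powr (1 - \<alpha>) \<and>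
      real (cf_denom \<theta> (n - 1)) powr (1 - \<alpha>) < B / (real M + 1) \<and> 0 < n) sequentially"
    by (intro frequently_eventually_frequently B eventually_conj)
  then obtain n' where "B \<le> real (cf_digit \<theta> n') * real (cf_denom \<theta> (n' - 1)) powr (1 - \<alpha>)"
      "real (cf_denom \<theta> (n' - 1)) powr (1 - \<alpha>) < B / (real M + 1)" "0 < n'"
    by (auto dest: frequently_ex)
  then obtain n where n: "B \<le> real (cf_digit \<theta> (Suc n)) * real (cf_denom \<theta> n) powr (1 - \<alpha>)"
      "real (cf_denom \<theta> n) powr (1 - \<alpha>) < B / (real M + 1)"
    by (metis Suc_pred' diff_Suc_1)
  have "B \<le> real (cf_digit \<theta> (Suc n)) * (B / (real M + 1))"
    using n by (meson less_imp_le mult_left_mono of_nat_0_le_iff order_trans)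
  then have "B * (real M + 1) \<le> B * real (cf_digit \<theta> (Suc n))"
    by (simp add: field_simps)
  then have "real M + 1 \<le> real (cf_digit \<theta> (Suc n))"
    using \<open>0 < B\<close> by (simp only: mult_le_cancel_left_pos)
  then have "9 \<le> cf_digit \<theta> (Suc n)" "4 * N \<le> cf_digit \<theta> (Suc n)"
    unfolding M_def by auto
  then obtain v k F where v: "v \<in> X" "v \<noteq> ?c" "common_prefix_length ?c v = k" "N \<le> k" "0 < k"
    and F: "finite F" "\<And>j. j \<in> F \<Longrightarrow> k < j \<and> right_special X (word_prefix ?c j)"
    and le: "growth_constant \<alpha> t * (real (cf_digit \<theta> (Suc n)) * real (cf_denom \<theta> n) powr (1 - \<alpha>)) powr (1 / \<alpha>)
       \<le> (\<Sum>j\<in>F. real j powr (- t)) * real k powr (t - 1 + 1 / \<alpha>)"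
    unfolding X_def using sum_sturmian_word_special_ge[OF \<open>1 < \<alpha>\<close> \<open>0 < t\<close> assms(5)] by metis
  have "growth_constant \<alpha> t * B powr (1 / \<alpha>) \<le>
      growth_constant \<alpha> t * (real (cf_digit \<theta> (Suc n)) * real (cf_denom \<theta> n) powr (1 - \<alpha>)) powr (1 / \<alpha>)"
    using n assms by (intro mult_left_mono powr_mono2) (auto simp: growth_constant_def)
  also note le
  also have "(\<Sum>j\<in>F. real j powr (- t)) * real k powr (t - 1 + 1 / \<alpha>) =
      (\<Sum>j\<in>F. real j powr (- t)) / real k powr (- (t - 1 + 1 / \<alpha>))"
    by (simp only: powr_minus divide_inverse inverse_inverse_eq)
  finally have "ennreal (growth_constant \<alpha> t * B powr (1 / \<alpha>)) \<le>
      ennreal ((\<Sum>j\<in>F. real j powr (- t)) / real k powr (- (t - 1 + 1 / \<alpha>)))"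
    by (rule ennreal_leI)
  also have "\<dots> = ennreal (\<Sum>j\<in>F. \<delta> j) / ennreal (real k powr (- (t - 1 + 1 / \<alpha>)))"
    using v by (subst divide_ennreal) (auto simp: \<delta>_def sum_nonneg)
  also have "\<dots> \<le> spectral_metric X \<delta> ?c v / ennreal (real k powr (- (t - 1 + 1 / \<alpha>)))"
    using v F by (intro divide_right_mono_ennreal spectral_metric_ge) (auto simp: \<delta>_def)
  also have "real k powr (- (t - 1 + 1 / \<alpha>)) = ultrametric \<delta> ?c v powr critical_exponent \<alpha> t"
    using v assms ultrametric_powr_critical_exponent[of v ?c t \<alpha>] by (simp add: \<delta>_def)
  also have "spectral_metric X \<delta> ?c v / ennreal (ultrametric \<delta> ?c v powr critical_exponent \<alpha> t) \<le>
      Sup ((\<lambda>v. spectral_metric X \<delta> ?c v / ennreal (ultrametric \<delta> ?c v powr critical_exponent \<alpha> t)) ` Collect P)"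
    using P[of v] v by (intro Sup_upper) auto
  finally show "ennreal (growth_constant \<alpha> t * B powr (1 / \<alpha>)) \<le> \<dots>" .
qed

end

section \<open>Growth of the partial quotients and regularity\<close>

lemma cf_growth_less_eventually:
  assumes "cf_growth \<alpha> \<theta> < ennreal B"
  shows "eventually (\<lambda>n. real (cf_digit \<theta> n) * real (cf_denom \<theta> (n - 1)) powr (1 - \<alpha>) \<le> B) sequentially"
  using Limsup_lessD[OF assms[unfolded cf_growth_def]]
  by eventually_elim (simp add: ennreal_less_iff)

lemma less_cf_growth_frequently:
  assumes "ennreal B < cf_growth \<alpha> \<theta>" "0 \<le> B"
  shows "frequently (\<lambda>n. B \<le> real (cf_digit \<theta> n) * real (cf_denom \<theta> (n - 1)) powr (1 - \<alpha>)) sequentially"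
proof (rule ccontr)
  assume "\<not> ?thesis"
  then have "eventually (\<lambda>n. ennreal (real (cf_digit \<theta> n) * real (cf_denom \<theta> (n - 1)) powr (1 - \<alpha>)) \<le> ennreal B) sequentially"
    unfolding not_frequently by eventually_elim (simp add: ennreal_leI)
  then have "cf_growth \<alpha> \<theta> \<le> ennreal B"
    unfolding cf_growth_def by (rule Limsup_bounded)
  then show False using assms by simp
qed

context unit_irrational
begin

context
  fixes \<alpha> t \<psi>
  assumes \<alpha>: "1 < \<alpha>" and t: "0 < t" "t < 1" "0 < t - 1 + 1 / \<alpha>"
  defines "\<psi> \<equiv> holder_psi (sturmian_subshift \<theta>)
      (spectral_metric (sturmian_subshift \<theta>) (\<lambda>n. real n powr (- t)))
      (ultrametric (\<lambda>n. real n powr (- t))) (critical_exponent \<alpha> t)"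
begin

lemma holder_psi_le:
  assumes "cf_growth \<alpha> \<theta> < ennreal B" "0 \<le> B" "0 < e"
  shows "\<psi> \<le> ennreal (e + 2 * tail_constant \<alpha> t * B powr (1 / \<alpha>))"
  unfolding \<psi>_def holder_psi_def
  by (intro SUP_least holder_psi_at_le \<alpha> t assms cf_growth_less_eventually)

lemma holder_psi_ge:
  assumes "ennreal B < cf_growth \<alpha> \<theta>" "0 < B"
  shows "ennreal (growth_constant \<alpha> t * B powr (1 / \<alpha>)) \<le> \<psi>"
  unfolding \<psi>_def holder_psi_def
  by (rule SUP_upper2[OF sturmian_word_in_subshift])
     (use \<alpha> t assms in \<open>intro holder_psi_at_ge less_cf_growth_frequently, auto\<close>)

lemma holder_psi_finite_iff: "\<psi> < \<infinity> \<longleftrightarrow> cf_growth \<alpha> \<theta> < \<infinity>"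
proof
  assume "cf_growth \<alpha> \<theta> < \<infinity>"
  then obtain x where x: "0 \<le> x" "cf_growth \<alpha> \<theta> = ennreal x" by (auto simp: less_top_ennreal)
  then have "cf_growth \<alpha> \<theta> < ennreal (x + 1)" by (simp add: ennreal_less_iff)
  then have "\<psi> \<le> ennreal (1 + 2 * tail_constant \<alpha> t * (x + 1) powr (1 / \<alpha>))"
    using x by (intro holder_psi_le) auto
  also have "\<dots> < \<infinity>" by simp
  finally show "\<psi> < \<infinity>" .
next
  assume "\<psi> < \<infinity>"
  then obtain x where x: "0 \<le> x" "\<psi> = ennreal x" by (auto simp: less_top_ennreal)
  show "cf_growth \<alpha> \<theta> < \<infinity>"
  proof (rule ccontr)
    \<comment> \<open>Solves
      \<open>growth_constant \<alpha> t * B powr (1 / \<alpha>) = x + 1\<close>, which exceeds the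
      assumed value \<open>x\<close> of \<psi>.\<close>
    define B where "B = ((x + 1) / growth_constant \<alpha> t) powr \<alpha>"
    have pos: "0 < growth_constant \<alpha> t" by (simp add: growth_constant_def)
    then have B: "0 < B" "B powr (1 / \<alpha>) = (x + 1) / growth_constant \<alpha> t"
      using x \<alpha> by (simp_all add: B_def powr_powr)
    assume "\<not> cf_growth \<alpha> \<theta> < \<infinity>"
    then have "ennreal B < cf_growth \<alpha> \<theta>" by (simp add: not_less top_unique)
    then have "ennreal (x + 1) \<le> \<psi>"
      using holder_psi_ge[of B] B pos by simp
    then show False using x by simp
  qed
qed

lemma holder_psi_pos_iff: "0 < \<psi> \<longleftrightarrow> 0 < cf_growth \<alpha> \<theta>"
proof
  assume "0 < cf_growth \<alpha> \<theta>"
  \<comment> \<open>An intermediate value is finite even when the growth is infinite.\<close>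
  then obtain y where y: "0 < y" "y < cf_growth \<alpha> \<theta>" using dense by blast
  then have "y < \<infinity>" by (metis infinity_ennreal_def order_less_le_trans top_greatest)
  then obtain B where "y = ennreal B" by (auto simp: less_top_ennreal)
  with y have B: "0 < B" "ennreal B < cf_growth \<alpha> \<theta>" by auto
  have "0 < ennreal (growth_constant \<alpha> t * B powr (1 / \<alpha>))"
    using B by (simp add: growth_constant_def)
  also have "\<dots> \<le> \<psi>" using B by (intro holder_psi_ge)
  finally show "0 < \<psi>" .
next
  assume "0 < \<psi>"
  show "0 < cf_growth \<alpha> \<theta>"
  proof (rule ccontr)
    assume "\<not> 0 < cf_growth \<alpha> \<theta>"
    then have zero: "cf_growth \<alpha> \<theta> = 0" by (simp add: zero_less_iff_neq_zero)
    define K where "K = 2 * tail_constant \<alpha> t"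
    have K: "0 \<le> K" using tail_constant_nonneg[OF \<alpha> t(2,3)] by (simp add: K_def)
    have "\<psi> \<le> 0 + ennreal e" if "0 < e" for e
    proof -
      \<comment> \<open>Chosen so that the tails contribute at most \<open>e / 2\<close>; the
        \<open>+ 1\<close> avoids a division by 0 when \<open>K = 0\<close>.\<close>
      define B where "B = (e / 2 / (K + 1)) powr \<alpha>"
      have B: "0 < B" "B powr (1 / \<alpha>) = e / 2 / (K + 1)"
        using that K \<alpha> by (simp_all add: B_def powr_powr)
      have "\<psi> \<le> ennreal (e / 2 + K * B powr (1 / \<alpha>))"
        unfolding K_def using that B by (intro holder_psi_le) (simp_all add: zero)
      also have "K * B powr (1 / \<alpha>) \<le> e / 2"
        using that K by (simp add: B field_simps)
      then have "ennreal (e / 2 + K * B powr (1 / \<alpha>)) \<le> ennreal e"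
        by (intro ennreal_leI) simp
      finally show ?thesis by simp
    qed
    then have "\<psi> \<le> 0" by (rule ennreal_le_epsilon)
    then show False using \<open>0 < \<psi>\<close> by simp
  qed
qed

end

end

theorem theorem3p1:
  fixes \<theta> \<alpha> t :: real and X :: "(nat \<Rightarrow> int) set" and \<delta> :: "nat \<Rightarrow> real"
  assumes "\<theta> \<in> {0..1}" and "\<theta> \<notin> \<rat>"
    and "X = sturmian_subshift \<theta>"
    and "\<alpha> > 1" and "t \<in> {1 - 1 / \<alpha><..<1}"
    and "\<delta> = (\<lambda>n. real n powr (- t))"
  shows "(seq_upper_holder_regular X (spectral_metric X \<delta>) (ultrametric \<delta>) (critical_exponent \<alpha> t)
            \<longleftrightarrow> \<theta> \<in> Theta_upper \<alpha>) \<and>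
         (seq_lower_holder_regular X (spectral_metric X \<delta>) (ultrametric \<delta>) (critical_exponent \<alpha> t)
            \<longleftrightarrow> \<theta> \<in> Theta_lower \<alpha>) \<and>
         (seq_holder_regular X (spectral_metric X \<delta>) (ultrametric \<delta>) (critical_exponent \<alpha> t)
            \<longleftrightarrow> \<theta> \<in> Theta \<alpha>)"
proof -
  interpret unit_irrational \<theta> by standard (use assms in auto)
  \<comment> \<open>The lower limit for \<open>t\<close> says that the rate
    \<open>t - 1 + 1 / \<alpha>\<close> is positive, as the geometric series requires.\<close>
  have "1 / \<alpha> < 1" and "1 - 1 / \<alpha> < t" using assms by simp_all
  then have t: "0 < t" "t < 1" "0 < t - 1 + 1 / \<alpha>" using assms(5) by simp_all
  show ?thesis
    using holder_psi_finite_iff[OF \<open>\<alpha> > 1\<close> t] holder_psi_pos_iff[OF \<open>\<alpha> > 1\<close> t] assms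
    by (auto simp: seq_upper_holder_regular_def seq_lower_holder_regular_def seq_holder_regular_def
        Theta_upper_def Theta_lower_def Theta_def)
qed

end
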